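(* Let $f,g$ satisfy the standing assumptions below, let $\beta\ge\frac{4Q_gM_f}{\mu^3}$ and $\hat\beta\ge\beta\max\{\frac{8L_g^2}{\mu},\frac1{4\mu},\frac\mu4\}$. Consider Algorithm 2: from $(x_0,y_0)$, for $k=0,1,\dots$: compute $w_k$ with $\|\nabla^2_{yy}g(x_k,y_k)w_k-\nabla_yg(x_k,y_k)\|\le\varepsilon_{1,k}$; choose $(d_{x,k},d_{y,k})\in\mathcal{D}_f(x_k,y_k-w_k)$; compute $v_k$ with $\|\nabla^2_{yy}g(x_k,y_k)v_k-d_{y,k}\|\le\varepsilon_{2,k}$; set $x_{k+1}=x_k-\eta_k(d_{x,k}-\nabla^2_{xy}g(x_k,y_k)v_k)$ and $y_{k+1}=y_k-\eta_k\hat\beta\nabla_yg(x_k,y_k)$. Suppose: (a) $\sup_k\|x_k\|+\|y_k\|<\infty$; (b) $\eta_k\ge0$, $\sum_k\eta_k=\infty$, $\sum_k\eta_k^2<\infty$; (c) the set $\{f(x,y):(x,y)\text{ is a }\mathcal{D}_f\text{-stationary point of (BLO)}\}$ has empty interior; and $\lim_k\varepsilon_{1,k}=0$, $\sum_k\varepsilon_{2,k}\eta_k<\infty$. Then every limit point of $\{(x_k,y_k)\}$ is a $\mathcal{D}_f$-stationary point of (BLO), and $\{h(x_k,y_k)\}$ converges.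
   Context: Standing assumptions. (A1) Constants $M_f,\mu,L_g,Q_g>0$ exist such that: $f:\mathbb{R}^n\times\mathbb{R}^p\to\mathbb{R}$ is $M_f$-Lipschitz; $g$ is twice differentiable with $\nabla^2_{yy}g\succeq\mu I_p$; $\nabla g$ is $L_g$-Lipschitz; $\nabla^2_{yy}g,\nabla^2_{xy}g$ are $Q_g$-Lipschitz; $\nabla^2_{yy}g$ is continuously differentiable ($\nabla^2_{xy}g\in\mathbb{R}^{n\times p}$ has entries $\partial^2g/\partial x_i\partial y_j$). (A2) $f$ is a potential function of a conservative field $\mathcal{D}_f$ with compact convex values of norm at most $M_f$ (conservative field: closed graph, nonempty compact values, $\int_0^1\max_{v\in\mathcal{D}(\gamma(t))}\langle\gamma'(t),v\rangle dt=0$ along every absolutely continuous loop; potential: $f(\gamma(1))-f(\gamma(0))$ equals this integral along any absolutely continuous curve). Notation: $\mathcal{A}(x,y):=y-\nabla^2_{yy}g(x,y)^{-1}\nabla_yg(x,y)$, $h(x,y):=f(x,\mathcal{A}(x,y))+\frac\beta2\|\nabla_yg(x,y)\|^2$. $(x,y)$ is a $\mathcal{D}_f$-stationary point of (BLO) (the problem $\min f(x,y)$ s.t. $y=\arg\min_{y'}g(x,y')$) if there is $(d_x,d_y)\in\mathcal{D}_f(x,y)$ with $d_x-\nabla^2_{xy}g(x,y)\nabla^2_{yy}g(x,y)^{-1}d_y=0$ and $\nabla_yg(x,y)=0$. *)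

theory Defs
  imports "HOL-Analysis.Analysis"
begin

definition abs_cont_curve :: "(real \<Rightarrow> 'a::euclidean_space) \<Rightarrow> bool" where
  "abs_cont_curve \<gamma> \<longleftrightarrow>
     (\<forall>\<epsilon>>0. \<exists>\<delta>>0. \<forall>(n::nat) (a::nat \<Rightarrow> real) (b::nat \<Rightarrow> real).
        (\<forall>i<n. 0 \<le> a i \<and> a i \<le> b i \<and> b i \<le> 1) \<longrightarrow>
        (\<forall>i<n. \<forall>j<n. i \<noteq> j \<longrightarrow> b i \<le> a j \<or> b j \<le> a i) \<longrightarrow>
        (\<Sum>i<n. b i - a i) < \<delta> \<longrightarrow>
        (\<Sum>i<n. norm (\<gamma> (b i) - \<gamma> (a i))) < \<epsilon>)"

definition ae_deriv_curve :: "(real \<Rightarrow> 'a::euclidean_space) \<Rightarrow> (real \<Rightarrow> 'a) \<Rightarrow> bool" where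
  "ae_deriv_curve \<gamma> \<gamma>' \<longleftrightarrow>
     (AE t in lborel. t \<in> {0..1} \<longrightarrow> (\<gamma> has_vector_derivative \<gamma>' t) (at t))"

text \<open>The integrand t \<mapsto> max over v in D(\<gamma> t) of the inner product of \<gamma>'(t) and v
  (the max exists since the values are compact and nonempty; written as Sup).\<close>
definition field_integrand ::
  "('a::euclidean_space \<Rightarrow> 'a set) \<Rightarrow> (real \<Rightarrow> 'a) \<Rightarrow> (real \<Rightarrow> 'a) \<Rightarrow> real \<Rightarrow> real" where
  "field_integrand D \<gamma> \<gamma>' t = Sup ((\<lambda>v. \<gamma>' t \<bullet> v) ` D (\<gamma> t))"

definition conservative_field :: "('a::euclidean_space \<Rightarrow> 'a set) \<Rightarrow> bool" where
  "conservative_field D \<longleftrightarrow>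
     closed {(z, d). d \<in> D z} \<and>
     (\<forall>z. D z \<noteq> {} \<and> compact (D z)) \<and>
     (\<forall>\<gamma> \<gamma>'. abs_cont_curve \<gamma> \<and> \<gamma> 0 = \<gamma> 1 \<and> ae_deriv_curve \<gamma> \<gamma>' \<longrightarrow>
        (field_integrand D \<gamma> \<gamma>' has_integral 0) {0..1})"

definition potential_of :: "('a::euclidean_space \<Rightarrow> real) \<Rightarrow> ('a \<Rightarrow> 'a set) \<Rightarrow> bool" where
  "potential_of f D \<longleftrightarrow>
     conservative_field D \<and>
     (\<forall>\<gamma> \<gamma>'. abs_cont_curve \<gamma> \<and> ae_deriv_curve \<gamma> \<gamma>' \<longrightarrow>
        (field_integrand D \<gamma> \<gamma>' has_integral (f (\<gamma> 1) - f (\<gamma> 0))) {0..1})"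

definition opnorm :: "real^'m^'k \<Rightarrow> real" where
  "opnorm M = onorm (\<lambda>v. M *v v)"

text \<open>Map A(x,y) = y - (Hess_yy g)^{-1} grad_y g, given Gy = grad_y g and Hyy = Hess_yy g.\<close>
definition A_map :: "('z \<Rightarrow> real^'p) \<Rightarrow> ('z \<Rightarrow> real^'p^'p) \<Rightarrow> 'z \<Rightarrow> real^'p \<Rightarrow> real^'p" where
  "A_map Gy Hyy z y = y - matrix_inv (Hyy z) *v Gy z"

definition h_fun ::
  "(((real^'n) \<times> (real^'p)) \<Rightarrow> real) \<Rightarrow> (((real^'n) \<times> (real^'p)) \<Rightarrow> real^'p)
   \<Rightarrow> (((real^'n) \<times> (real^'p)) \<Rightarrow> real^'p^'p) \<Rightarrow> real \<Rightarrow> ((real^'n) \<times> (real^'p)) \<Rightarrow> real" where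
  "h_fun f Gy Hyy \<beta> z = f (fst z, A_map Gy Hyy z (snd z)) + \<beta> / 2 * (norm (Gy z))\<^sup>2"

text \<open>D_f-stationary point of (BLO); Hxy z is the n x p matrix of mixed second derivatives.\<close>
definition stationary_BLO ::
  "(((real^'n) \<times> (real^'p)) \<Rightarrow> (((real^'n) \<times> (real^'p))) set) \<Rightarrow> (((real^'n) \<times> (real^'p)) \<Rightarrow> real^'p)
   \<Rightarrow> (((real^'n) \<times> (real^'p)) \<Rightarrow> real^'p^'n) \<Rightarrow> (((real^'n) \<times> (real^'p)) \<Rightarrow> real^'p^'p)
   \<Rightarrow> ((real^'n) \<times> (real^'p)) \<Rightarrow> bool" where
  "stationary_BLO Df Gy Hxy Hyy z \<longleftrightarrow>
     (\<exists>dx dy. (dx, dy) \<in> Df z \<and> dx - Hxy z *v (matrix_inv (Hyy z) *v dy) = 0) \<and> Gy z = 0"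

end

theory Submission
  imports Defs "HOL-Complex_Analysis.Great_Picard"
begin

text \<open>
  Adding the tails of the summable errors, the iteration becomes an exact Euler scheme for the
  differential inclusion \<open>z' \<in> - G z\<close>, where \<open>G (x, y)\<close> consists of the vectors
  \<open>(d\<^sub>x - H\<^sub>x\<^sub>y H\<^sub>y\<^sub>y\<^sup>-\<^sup>1 d\<^sub>y, \<beta>h \<nabla>\<^sub>y g)\<close> with \<open>(d\<^sub>x, d\<^sub>y)\<close> in the conservative field at \<open>(x, A(x, y))\<close>.
  Time-shifted interpolations converge to Lipschitz curves that satisfy the inclusion wherever they
  are differentiable, hence almost everywhere. Along such a curve the potential property of \<open>f\<close>,
  applied to the curve \<open>(x, A(x, y))\<close> traversed backwards, shows that \<open>h\<close> decreases at a rate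
  proportional to the squared speed: the maximum over the field dominates the pairing with the
  element selected by the inclusion.
  If \<open>h\<close> oscillated along the iterates, a value that is not critical would be up-crossed
  infinitely often, and a limit curve started at such crossings would contradict the strict decrease.
  Once \<open>h\<close> converges along the iterates, a limit curve from a non-stationary limit point would
  produce a limit point with a smaller value of \<open>h\<close>.
\<close>

section \<open>Lipschitz functions of a real variable\<close>

text \<open>The potential identity integrates a maximum over the field, so a selected element bounds
  the change of \<open>f\<close> along a curve only from below. Along a descending trajectory this
  is the wrong direction; time reversal turns it into an upper bound for the final value. The
  identity concerns curves with an almost everywhere derivative, whereas limits of interpolations
  are merely Lipschitz, which is why such derivatives are built here from Stieltjes measures. The
  two inexact solves need different treatment. The residual of \<open>v\<close> may stay large where
  steps are small: only its product with the step size is summable, so it is removed by the shift.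
  The residual of \<open>w\<close> tends to zero without any rate, so it stays inside the argument
  of the field and disappears in the closed-graph limit. Composing \<open>f\<close> with the Newton
  map cancels the first-order effect of moving in \<open>y\<close>. What is left is a
  third-derivative term bounded by a multiple of the norm of \<open>Gy\<close> times the speed, and
  the penalty with weight \<beta> dominates it.\<close>

lemma emeasure_interval_measure_Ioo:
  assumes "a \<le> b"
    and mono_F: "\<And>x y. x \<le> y \<Longrightarrow> F x \<le> F y"
    and cont_F: "continuous_on UNIV F"
  shows "emeasure (interval_measure F) {a<..<b} = ennreal (F b - F a)"
proof -
  have sing: "{x} \<in> null_sets (interval_measure F)" for x
    using emeasure_interval_measure_Icc[of x x F] mono_F cont_F by (auto simp: null_sets_def)
  have "emeasure (interval_measure F) {a<..<b} = emeasure (interval_measure F) ({a..b} - {a} - {b})"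
    by (rule arg_cong[where f="emeasure _"]) auto
  also have "\<dots> = emeasure (interval_measure F) {a..b}"
    using sing by (subst emeasure_Diff_null_set | simp)+
  also have "\<dots> = ennreal (F b - F a)"
    using assms by (intro emeasure_interval_measure_Icc) auto
  finally show ?thesis .
qed

text \<open>The Stieltjes measures of \<open>F\<close> and of \<open>\<lambda>x. x - F x\<close> add up to Lebesgue measure.\<close>
lemma interval_measure_absolutely_continuous:
  assumes mono_F: "\<And>x y. x \<le> y \<Longrightarrow> F x \<le> F y"
    and nonexp: "\<And>x y. x \<le> y \<Longrightarrow> F y - F x \<le> y - x"
    and cont_F: "continuous_on UNIV F"
  shows "absolutely_continuous lborel (interval_measure F)"
proof -
  define G where "G x = x - F x" for x
  have mono_G: "x \<le> y \<Longrightarrow> G x \<le> G y" for x y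
    using nonexp[of x y] by (simp add: G_def)
  have cont_G: "continuous_on UNIV G"
    unfolding G_def by (intro continuous_intros cont_F)
  define \<nu> where "\<nu> A = emeasure (interval_measure F) A + emeasure (interval_measure G) A" for A
  define M where "M = measure_of UNIV (sets borel) \<nu>"
  have sets_M: "sets M = sets (borel :: real measure)"
    unfolding M_def by (simp add: sets.sigma_sets_eq[of borel, simplified])
  have em: "emeasure M A = \<nu> A" if "A \<in> sets borel" for A
  proof (rule emeasure_measure_of[OF M_def])
    show "positive (sets M) \<nu>"
      by (simp add: positive_def \<nu>_def)
    show "countably_additive (sets M) \<nu>"
    proof (rule countably_additiveI)
      fix A :: "nat \<Rightarrow> real set"
      assume A: "range A \<subseteq> sets M" "disjoint_family A" "\<Union> (range A) \<in> sets M"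
      have "(\<Sum>i. \<nu> (A i)) = (\<Sum>i. emeasure (interval_measure F) (A i)) + (\<Sum>i. emeasure (interval_measure G) (A i))"
        unfolding \<nu>_def by (intro suminf_add[symmetric]) auto
      also have "\<dots> = \<nu> (\<Union> (range A))"
        using A sets_M by (simp add: \<nu>_def suminf_emeasure)
      finally show "(\<Sum>i. \<nu> (A i)) = \<nu> (\<Union> (range A))" .
    qed
  qed (use that sets_M in auto)
  have "lborel = M"
  proof (rule lborel_eqI[OF _ sets_M])
    fix l u :: real
    assume "\<And>b. b \<in> Basis \<Longrightarrow> l \<bullet> b \<le> u \<bullet> b"
    then have lu: "l \<le> u" by simp
    have "emeasure M (box l u) = ennreal (F u - F l) + ennreal (G u - G l)"
      by (simp add: em \<nu>_def box_real emeasure_interval_measure_Ioo[OF lu mono_F cont_F]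
          emeasure_interval_measure_Ioo[OF lu mono_G cont_G])
    also have "\<dots> = ennreal (u - l)"
      using mono_F[OF lu] mono_G[OF lu] by (subst ennreal_plus[symmetric]) (auto simp: G_def)
    finally show "emeasure M (box l u) = ennreal (\<Prod>b\<in>Basis. (u - l) \<bullet> b)"
      by simp
  qed
  then have "emeasure lborel A = \<nu> A" if "A \<in> sets borel" for A
    using em that by simp
  then show ?thesis
    unfolding absolutely_continuous_def null_sets_def by (auto simp: \<nu>_def)
qed

text \<open>The Stieltjes measure of \<open>F\<close> is absolutely continuous, so Radon-Nikodym
  supplies a density. It takes extended values and may be infinite on a null set, hence the passage
  through \<open>enn2real\<close>.\<close>

lemma nonexpansive_mono_density:
  fixes F :: "real \<Rightarrow> real"
  assumes mono_F: "\<And>x y. x \<le> y \<Longrightarrow> F x \<le> F y"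
    and nonexp: "\<And>x y. x \<le> y \<Longrightarrow> F y - F x \<le> y - x"
  shows "\<exists>\<phi>. \<forall>a b. a \<le> b \<longrightarrow> (\<phi> has_integral (F b - F a)) {a..b}"
proof -
  have "1-lipschitz_on UNIV F"
  proof (rule lipschitz_onI)
    show "dist (F x) (F y) \<le> 1 * dist x y" for x y
      using mono_F[of x y] nonexp[of x y] mono_F[of y x] nonexp[of y x]
      by (cases "x \<le> y") (auto simp: dist_real_def)
  qed simp
  then have cont_F: "continuous_on UNIV F"
    by (rule lipschitz_on_continuous_on)
  have "absolutely_continuous lborel (interval_measure F)"
    using mono_F nonexp cont_F by (rule interval_measure_absolutely_continuous)
  then obtain f where f[measurable]: "f \<in> borel_measurable lborel"
    and dens: "density lborel f = interval_measure F"
    using sigma_finite_measure.Radon_Nikodym[OF sigma_finite_lborel, of "interval_measure F"] by auto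
  have f_int: "(\<integral>\<^sup>+x. f x * indicator {a..b} x \<partial>lborel) = ennreal (F b - F a)" if "a \<le> b" for a b
    using emeasure_interval_measure_Icc[OF that mono_F cont_F]
    by (simp add: dens[symmetric] emeasure_density)
  define \<phi> where "\<phi> x = enn2real (f x)" for x
  have \<phi>_meas[measurable]: "\<phi> \<in> borel_measurable borel"
    unfolding \<phi>_def using f by measurable
  have "(\<phi> has_integral (F b - F a)) {a..b}" if "a \<le> b" for a b
  proof -
    have "AE x in lborel. f x * indicator {a..b} x \<noteq> \<infinity>"
      by (rule nn_integral_PInf_AE) (auto simp: f_int[OF that])
    then have "AE x in lborel. ennreal (indicator {a..b} x * \<phi> x) = f x * indicator {a..b} x"
      by (rule AE_mp) (auto intro!: AE_I2 simp: \<phi>_def ennreal_enn2real_if split: split_indicator)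
    then have "(\<integral>\<^sup>+x. ennreal (indicator {a..b} x * \<phi> x) \<partial>lborel) = ennreal (F b - F a)"
      using f_int[OF that] by (subst nn_integral_cong_AE) auto
    then have "((\<lambda>x. indicator {a..b} x * \<phi> x) has_integral (F b - F a)) UNIV"
      using mono_F[OF that] by (intro nn_integral_has_integral) (auto simp: \<phi>_def)
    moreover have "(\<lambda>x. indicator {a..b} x * \<phi> x) = (\<lambda>x. if x \<in> {a..b} then \<phi> x else 0)"
      by (auto split: split_indicator)
    ultimately show ?thesis
      using has_integral_restrict_UNIV[of "{a..b}" \<phi> "F b - F a"] by simp
  qed
  then show ?thesis by blast
qed

lemma lipschitz_on_real_density:
  fixes F :: "real \<Rightarrow> real"
  assumes "L-lipschitz_on UNIV F"
  shows "\<exists>\<phi>. \<forall>a b. a \<le> b \<longrightarrow> (\<phi> has_integral (F b - F a)) {a..b}"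
proof -
  \<comment> \<open>Adding \<open>K * x\<close> makes \<open>F\<close> monotone, and dividing by
    \<open>2 * K\<close> makes the sum nonexpansive; the extra 1 keeps this divisor positive when
    \<open>L = 0\<close>.\<close>
  define K where "K = L + 1"
  have K: "K > 0"
    using lipschitz_on_nonneg[OF assms] by (simp add: K_def)
  have lip: "\<bar>F y - F x\<bar> \<le> K * (y - x)" if "x \<le> y" for x y
  proof -
    have "\<bar>F y - F x\<bar> \<le> L * (y - x)"
      using lipschitz_onD[OF assms, of y x] that by (simp add: dist_real_def)
    then show ?thesis using that by (simp add: K_def algebra_simps)
  qed
  define F1 where "F1 x = (F x + K * x) / (2 * K)" for x
  have "\<exists>\<phi>. \<forall>a b. a \<le> b \<longrightarrow> (\<phi> has_integral (F1 b - F1 a)) {a..b}"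
  proof (rule nonexpansive_mono_density)
    fix x y :: real assume "x \<le> y"
    from lip[OF this] have le: "F x - F y \<le> K * y - K * x" "F y - F x \<le> K * y - K * x"
      by (auto simp: algebra_simps)
    show "F1 x \<le> F1 y"
      unfolding F1_def using K le by (intro divide_right_mono) auto
    have "F1 y - F1 x = (F y - F x + K * (y - x)) / (2 * K)"
      by (simp add: F1_def diff_divide_distrib[symmetric] algebra_simps)
    also have "\<dots> \<le> y - x"
      using K le by (subst pos_divide_le_eq) (auto simp: algebra_simps)
    finally show "F1 y - F1 x \<le> y - x" .
  qed
  then obtain \<phi> where \<phi>: "\<And>a b. a \<le> b \<Longrightarrow> (\<phi> has_integral (F1 b - F1 a)) {a..b}"
    by blast
  have "((\<lambda>x. 2 * K * \<phi> x - K) has_integral (F b - F a)) {a..b}" if "a \<le> b" for a b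
  proof -
    have "((\<lambda>x. 2 * K * \<phi> x - K) has_integral (2 * K * (F1 b - F1 a) - (b - a) * K)) {a..b}"
      by (intro has_integral_diff has_integral_mult_right \<phi> that)
        (use has_integral_const_real[of K a b] that in simp)
    moreover have "2 * K * (F1 b - F1 a) - (b - a) * K = F b - F a"
      using K that by (simp add: F1_def field_simps)
    ultimately show ?thesis by simp
  qed
  then show ?thesis
    by (intro exI[of _ "\<lambda>x. 2 * K * \<phi> x - K"]) auto
qed

lemma AE_lborel_if_negligible:
  assumes "negligible N" and "\<And>x. x \<notin> N \<Longrightarrow> P x"
  shows "AE x in lborel. P x"
proof -
  have "N \<in> null_sets lebesgue"
    using assms(1) negligible_iff_null_sets by blast
  then have "AE x in lebesgue. P x"
    by (rule AE_I'[rotated 1, rotated 1]) (use assms(2) in blast)+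
  then show ?thesis
    by (simp add: AE_completion_iff)
qed

text \<open>The averaging theorem uses cubes whose lower corner is the point, so it yields right
  derivatives; applied to the reflected density it yields the left ones. One \<open>\<phi>\<close>
  serves both as integrand and as derivative, so that later an integral can be estimated from
  pointwise derivatives.\<close>

theorem lipschitz_on_real_derivative_AE:
  fixes F :: "real \<Rightarrow> real"
  assumes "L-lipschitz_on UNIV F"
  obtains \<phi> where "\<And>a b. a \<le> b \<Longrightarrow> (\<phi> has_integral (F b - F a)) {a..b}"
    and "AE t in lborel. (F has_vector_derivative \<phi> t) (at t)"
proof -
  obtain \<phi> where \<phi>: "\<And>a b. a \<le> b \<Longrightarrow> (\<phi> has_integral (F b - F a)) {a..b}"
    using lipschitz_on_real_density[OF assms] by blast
  have int: "\<phi> integrable_on cbox a b" for a b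
    using \<phi>[of a b] by (cases "a \<le> b") (auto intro: has_integral_integrable)
  have refl_int: "((\<lambda>x. \<phi> (- x)) has_integral (F (- a) - F (- b))) {a..b}" if "a \<le> b" for a b
    using has_integral_reflect_lemma_real[OF \<phi>[of "- b" "- a"]] that by simp
  have int': "(\<lambda>x. \<phi> (- x)) integrable_on cbox a b" for a b
    using refl_int[of a b] by (cases "a \<le> b") (auto intro: has_integral_integrable)
  obtain N where N: "negligible N"
    and right: "\<And>x e. \<lbrakk>x \<notin> N; 0 < e\<rbrakk> \<Longrightarrow> \<exists>d>0. \<forall>h. 0 < h \<and> h < d \<longrightarrow>
        norm (integral (cbox x (x + h *\<^sub>R One)) \<phi> /\<^sub>R h ^ DIM(real) - \<phi> x) < e"
    using integrable_ccontinuous_explicit[OF int] by metis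
  obtain N' where N': "negligible N'"
    and left: "\<And>x e. \<lbrakk>x \<notin> N'; 0 < e\<rbrakk> \<Longrightarrow> \<exists>d>0. \<forall>h. 0 < h \<and> h < d \<longrightarrow>
        norm (integral (cbox x (x + h *\<^sub>R One)) (\<lambda>x. \<phi> (- x)) /\<^sub>R h ^ DIM(real) - \<phi> (- x)) < e"
    using integrable_ccontinuous_explicit[OF int'] by metis
  have "negligible (uminus ` N')"
    by (intro negligible_differentiable_image_negligible[OF _ N'])
      (auto simp: differentiable_on_def intro!: derivative_intros)
  then have "negligible (N \<union> uminus ` N')"
    using N by simp
  moreover have "(F has_vector_derivative \<phi> t) (at t)" if "t \<notin> N \<union> uminus ` N'" for t
  proof -
    have tN: "t \<notin> N" "- t \<notin> N'"
      using that by (auto simp: image_iff)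
    have "(F has_real_derivative \<phi> t) (at t)"
      unfolding has_field_derivative_def has_derivative_at_alt
    proof (intro conjI allI impI)
      fix e :: real assume e: "e > 0"
      obtain d1 where d1: "d1 > 0" and D1: "\<And>h. 0 < h \<Longrightarrow> h < d1 \<Longrightarrow> \<bar>(F (t + h) - F t) / h - \<phi> t\<bar> < e"
        using right[OF tN(1) e] by (auto simp: integral_unique[OF \<phi>] divide_inverse mult.commute)
      obtain d2 where d2: "d2 > 0" and D2: "\<And>h. 0 < h \<Longrightarrow> h < d2 \<Longrightarrow> \<bar>(F t - F (t - h)) / h - \<phi> t\<bar> < e"
        using left[OF tN(2) e] by (auto simp: integral_unique[OF refl_int] divide_inverse mult.commute)
      show "\<exists>d>0. \<forall>y. norm (y - t) < d \<longrightarrow> norm (F y - F t - \<phi> t * (y - t)) \<le> e * norm (y - t)"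
      proof (intro exI[of _ "min d1 d2"] conjI allI impI)
        fix y assume y: "norm (y - t) < min d1 d2"
        consider "y = t" | "y > t" | "y < t" by linarith
        then show "norm (F y - F t - \<phi> t * (y - t)) \<le> e * norm (y - t)"
        proof cases
          case 2
          then have "\<bar>(F y - F t) / (y - t) - \<phi> t\<bar> < e"
            using D1[of "y - t"] y by auto
          moreover have "F y - F t - \<phi> t * (y - t) = ((F y - F t) / (y - t) - \<phi> t) * (y - t)"
            using 2 by (simp add: field_simps)
          ultimately show ?thesis
            by (auto simp: abs_mult intro!: mult_right_mono)
        next
          case 3
          then have "\<bar>(F t - F y) / (t - y) - \<phi> t\<bar> < e"
            using D2[of "t - y"] y by auto
          moreover have "F y - F t - \<phi> t * (y - t) = ((F t - F y) / (t - y) - \<phi> t) * (y - t)"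
            using 3 by (simp add: field_simps)
          ultimately show ?thesis
            by (auto simp: abs_mult intro!: mult_right_mono)
        qed simp
      qed (use d1 d2 in auto)
    qed (rule bounded_linear_mult_right)
    then show ?thesis
      by (simp add: has_real_derivative_iff_has_vector_derivative)
  qed
  ultimately have "AE t in lborel. (F has_vector_derivative \<phi> t) (at t)"
    by (rule AE_lborel_if_negligible)
  with \<phi> show thesis by (rule that)
qed

corollary lipschitz_on_vector_derivative_AE:
  fixes F :: "real \<Rightarrow> 'a::euclidean_space"
  assumes "L-lipschitz_on UNIV F"
  obtains F' where "AE t in lborel. (F has_vector_derivative F' t) (at t)"
proof -
  have "\<exists>\<phi>. AE t in lborel. ((\<lambda>t. F t \<bullet> b) has_vector_derivative \<phi> t) (at t)" if b: "b \<in> Basis" for b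
  proof -
    have "L-lipschitz_on UNIV (\<lambda>t. F t \<bullet> b)"
    proof (rule lipschitz_onI)
      fix x y
      have "dist (F x \<bullet> b) (F y \<bullet> b) \<le> dist (F x) (F y)"
        using Basis_le_norm[OF b, of "F x - F y"] by (simp add: dist_norm inner_diff_left)
      also have "\<dots> \<le> L * dist x y"
        using assms by (auto intro: lipschitz_onD)
      finally show "dist (F x \<bullet> b) (F y \<bullet> b) \<le> L * dist x y" .
    qed (rule lipschitz_on_nonneg[OF assms])
    then show ?thesis
      by (rule lipschitz_on_real_derivative_AE) blast
  qed
  then obtain \<phi> where \<phi>: "\<And>b. b \<in> Basis \<Longrightarrow> AE t in lborel. ((\<lambda>t. F t \<bullet> b) has_vector_derivative \<phi> b t) (at t)"
    by metis
  have "AE t in lborel. \<forall>b\<in>Basis. ((\<lambda>t. F t \<bullet> b) has_vector_derivative \<phi> b t) (at t)"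
    by (rule AE_finite_allI) (auto intro: \<phi>)
  then have "AE t in lborel. (F has_vector_derivative (\<Sum>b\<in>Basis. \<phi> b t *\<^sub>R b)) (at t)"
  proof (rule AE_mp, intro AE_I2 impI)
    fix t assume *: "\<forall>b\<in>Basis. ((\<lambda>t. F t \<bullet> b) has_vector_derivative \<phi> b t) (at t)"
    have "((\<lambda>t. \<Sum>b\<in>Basis. (F t \<bullet> b) *\<^sub>R b) has_vector_derivative (\<Sum>b\<in>Basis. \<phi> b t *\<^sub>R b)) (at t)"
      using * by (auto intro!: derivative_eq_intros simp: has_real_derivative_iff_has_vector_derivative[symmetric])
    then show "(F has_vector_derivative (\<Sum>b\<in>Basis. \<phi> b t *\<^sub>R b)) (at t)"
      by (simp add: euclidean_representation)
  qed
  then show thesis by (rule that)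
qed

section \<open>Symmetry of second derivatives\<close>

text \<open>The mean value theorem in direction \<open>a\<close> reduces the second difference to
  one increment of \<open>G\<close>, and both points of that increment lie within
  \<open>s * K\<close> of \<open>z\<close>, where differentiability of \<open>G\<close> at
  \<open>z\<close> controls it.\<close>

lemma second_difference_expansion:
  fixes g :: "'a::real_inner \<Rightarrow> real"
  assumes dg: "\<And>z. (g has_derivative (\<lambda>k. G z \<bullet> k)) (at z)"
    and dG: "(G has_derivative H) (at z)" and e: "e > 0"
  shows "\<exists>d>0. \<forall>s. 0 < s \<and> s < d \<longrightarrow>
    \<bar>g (z + s *\<^sub>R a + s *\<^sub>R b) - g (z + s *\<^sub>R a) - g (z + s *\<^sub>R b) + g z - s\<^sup>2 * (a \<bullet> H b)\<bar> \<le> e * s\<^sup>2"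
proof -
  interpret H: bounded_linear H
    using dG by (rule has_derivative_bounded_linear)
  define K where "K = norm a + norm b + 1"
  have K: "K \<ge> 1" "norm a \<le> K" "norm a + norm b \<le> K" by (auto simp: K_def)
  \<comment> \<open>Two values of \<open>G\<close> each contribute an error
    \<open>\<epsilon> * s * K\<close>, and pairing with \<open>a\<close> costs another factor
    \<open>K\<close>; together this is \<open>e * s\<close>.\<close>
  define \<epsilon> where "\<epsilon> = e / (2 * K\<^sup>2)"
  have \<epsilon>: "\<epsilon> > 0" using e K by (simp add: \<epsilon>_def)
  from dG \<epsilon> obtain \<delta> where \<delta>: "\<delta> > 0"
    and est: "\<And>y. norm (y - z) < \<delta> \<Longrightarrow> norm (G y - G z - H (y - z)) \<le> \<epsilon> * norm (y - z)"
    unfolding has_derivative_at_alt by blast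
  show ?thesis
  proof (intro exI[of _ "\<delta> / K"] conjI allI impI)
    show "\<delta> / K > 0" using \<delta> K by simp
    fix s assume s: "0 < s \<and> s < \<delta> / K"
    then have sK: "s * K < \<delta>" using K by (simp add: pos_less_divide_eq)
    define \<psi> where "\<psi> t = g (z + t *\<^sub>R a + s *\<^sub>R b) - g (z + t *\<^sub>R a)" for t
    have d\<psi>: "(\<psi> has_real_derivative (G (z + t *\<^sub>R a + s *\<^sub>R b) - G (z + t *\<^sub>R a)) \<bullet> a) (at t)" for t
    proof -
      have i1: "((\<lambda>t. z + t *\<^sub>R a + s *\<^sub>R b) has_derivative (\<lambda>h. h *\<^sub>R a)) (at t)"
        and i2: "((\<lambda>t. z + t *\<^sub>R a) has_derivative (\<lambda>h. h *\<^sub>R a)) (at t)"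
        by (auto intro!: derivative_eq_intros)
      have 1: "((\<lambda>t. g (z + t *\<^sub>R a + s *\<^sub>R b)) has_derivative (\<lambda>h. G (z + t *\<^sub>R a + s *\<^sub>R b) \<bullet> (h *\<^sub>R a))) (at t)"
        by (rule has_derivative_compose[OF i1 dg])
      have 2: "((\<lambda>t. g (z + t *\<^sub>R a)) has_derivative (\<lambda>h. G (z + t *\<^sub>R a) \<bullet> (h *\<^sub>R a))) (at t)"
        by (rule has_derivative_compose[OF i2 dg])
      show ?thesis
        unfolding \<psi>_def has_field_derivative_def
        by (rule has_derivative_eq_rhs[OF has_derivative_diff[OF 1 2]]) (auto simp: inner_diff_left algebra_simps)
    qed
    obtain \<theta> where \<theta>: "0 < \<theta>" "\<theta> < s"
      and mv: "\<psi> s - \<psi> 0 = (s - 0) * ((G (z + \<theta> *\<^sub>R a + s *\<^sub>R b) - G (z + \<theta> *\<^sub>R a)) \<bullet> a)"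
      using MVT2[of 0 s \<psi>, OF _ d\<psi>] s by auto
    define u where "u = G (z + \<theta> *\<^sub>R a + s *\<^sub>R b) - G (z + \<theta> *\<^sub>R a) - s *\<^sub>R H b"
    have n1: "norm (\<theta> *\<^sub>R a + s *\<^sub>R b) \<le> s * K"
    proof -
      have "norm (\<theta> *\<^sub>R a + s *\<^sub>R b) \<le> s * norm a + s * norm b"
        using \<theta> by (intro norm_triangle_le add_mono) (auto intro!: mult_right_mono)
      also have "\<dots> \<le> s * K" using K(3) s by (simp add: distrib_left[symmetric])
      finally show ?thesis .
    qed
    have n2: "norm (\<theta> *\<^sub>R a) \<le> s * K"
      using \<theta> K by (auto intro!: mult_mono)
    have "norm u \<le> norm (G (z + \<theta> *\<^sub>R a + s *\<^sub>R b) - G z - H (\<theta> *\<^sub>R a + s *\<^sub>R b))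
        + norm (G (z + \<theta> *\<^sub>R a) - G z - H (\<theta> *\<^sub>R a))"
      unfolding u_def by (rule order_trans[OF _ norm_triangle_ineq4]) (simp add: H.add H.scaleR algebra_simps)
    also have "\<dots> \<le> \<epsilon> * (s * K) + \<epsilon> * (s * K)"
    proof (rule add_mono)
      show "norm (G (z + \<theta> *\<^sub>R a + s *\<^sub>R b) - G z - H (\<theta> *\<^sub>R a + s *\<^sub>R b)) \<le> \<epsilon> * (s * K)"
        using est[of "z + (\<theta> *\<^sub>R a + s *\<^sub>R b)"] mult_left_mono[OF n1 less_imp_le[OF \<epsilon>]] n1 sK
        by (force simp: add.assoc)
      show "norm (G (z + \<theta> *\<^sub>R a) - G z - H (\<theta> *\<^sub>R a)) \<le> \<epsilon> * (s * K)"
        using est[of "z + \<theta> *\<^sub>R a"] mult_left_mono[OF n2 less_imp_le[OF \<epsilon>]] n2 sK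
        by force
    qed
    finally have nu: "norm u \<le> 2 * \<epsilon> * s * K" by (simp add: mult_ac)
    have "\<bar>u \<bullet> a\<bar> \<le> norm u * norm a"
      by (rule Cauchy_Schwarz_ineq2)
    also have "\<dots> \<le> (2 * \<epsilon> * s * K) * K"
      using nu K \<epsilon> s by (intro mult_mono) auto
    also have "\<dots> = e * s"
      using K by (simp add: \<epsilon>_def power2_eq_square)
    finally have ua: "\<bar>u \<bullet> a\<bar> \<le> e * s" .
    have "\<psi> s - \<psi> 0 - s\<^sup>2 * (a \<bullet> H b) = s * (u \<bullet> a)"
      unfolding mv u_def by (simp add: inner_diff_left algebra_simps power2_eq_square inner_commute)
    then have "\<bar>\<psi> s - \<psi> 0 - s\<^sup>2 * (a \<bullet> H b)\<bar> = s * \<bar>u \<bullet> a\<bar>"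
      using s by (simp add: abs_mult)
    also have "\<dots> \<le> s * (e * s)"
      using ua s by (intro mult_left_mono) auto
    finally show "\<bar>g (z + s *\<^sub>R a + s *\<^sub>R b) - g (z + s *\<^sub>R a) - g (z + s *\<^sub>R b) + g z - s\<^sup>2 * (a \<bullet> H b)\<bar> \<le> e * s\<^sup>2"
      by (simp add: \<psi>_def algebra_simps power2_eq_square)
  qed
qed

text \<open>The second difference is unchanged when \<open>a\<close> and \<open>b\<close> are
  exchanged, so its two expansions agree to order \<open>s\<^sup>2\<close>.\<close>

lemma symmetric_second_derivative_inner:
  fixes g :: "'a::real_inner \<Rightarrow> real"
  assumes dg: "\<And>z. (g has_derivative (\<lambda>k. G z \<bullet> k)) (at z)"
    and dG: "(G has_derivative H) (at z)"
  shows "a \<bullet> H b = b \<bullet> H a"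
proof -
  have "\<bar>a \<bullet> H b - b \<bullet> H a\<bar> \<le> e" if e: "e > 0" for e
  proof -
    let ?D = "\<lambda>s. g (z + s *\<^sub>R a + s *\<^sub>R b) - g (z + s *\<^sub>R a) - g (z + s *\<^sub>R b) + g z"
    obtain d1 where d1: "d1 > 0" "\<And>s. 0 < s \<Longrightarrow> s < d1 \<Longrightarrow> \<bar>?D s - s\<^sup>2 * (a \<bullet> H b)\<bar> \<le> e / 2 * s\<^sup>2"
      using second_difference_expansion[OF dg dG, of "e / 2" a b] e by auto
    obtain d2 where d2: "d2 > 0" "\<And>s. 0 < s \<Longrightarrow> s < d2 \<Longrightarrow> \<bar>?D s - s\<^sup>2 * (b \<bullet> H a)\<bar> \<le> e / 2 * s\<^sup>2"
      using second_difference_expansion[OF dg dG, of "e / 2" b a] e by (auto simp: algebra_simps)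
    define s where "s = min d1 d2 / 2"
    have s: "0 < s" "s < d1" "s < d2" using d1 d2 by (auto simp: s_def)
    have "s\<^sup>2 * \<bar>a \<bullet> H b - b \<bullet> H a\<bar> = \<bar>s\<^sup>2 * (a \<bullet> H b) - s\<^sup>2 * (b \<bullet> H a)\<bar>"
      by (simp add: right_diff_distrib[symmetric] abs_mult)
    also have "\<dots> \<le> s\<^sup>2 * e"
    proof -
      have "\<bar>p - q\<bar> \<le> s\<^sup>2 * e" if "\<bar>r - p\<bar> \<le> e / 2 * s\<^sup>2" "\<bar>r - q\<bar> \<le> e / 2 * s\<^sup>2" for p q r :: real
      proof -
        have "\<bar>p - q\<bar> \<le> \<bar>r - p\<bar> + \<bar>r - q\<bar>" by arith
        then show ?thesis using that by (simp add: mult.commute)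
      qed
      then show ?thesis
        using d1(2)[OF s(1,2)] d2(2)[OF s(1,3)] by blast
    qed
    finally show ?thesis using s by simp
  qed
  then have "\<bar>a \<bullet> H b - b \<bullet> H a\<bar> \<le> 0"
    by (rule field_le_epsilon[of _ 0, simplified])
  then show ?thesis by simp
qed

section \<open>Euler schemes for differential inclusions\<close>

lemma strict_mono_choice:
  fixes Q :: "nat \<Rightarrow> nat \<Rightarrow> bool"
  assumes "\<And>n N. \<exists>k\<ge>N. Q n k"
  shows "\<exists>r. strict_mono r \<and> (\<forall>n. Q n (r n))"
proof -
  have "\<exists>r. \<forall>n. Q n (r n) \<and> r n < r (Suc n)"
  proof (rule dependent_nat_choice)
    show "\<exists>k. Q 0 k" using assms by blast
    show "\<exists>k'. Q (Suc n) k' \<and> k < k'" for k n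
      using assms[of "Suc k" "Suc n"] by (auto simp: Suc_le_eq)
  qed
  then show ?thesis by (auto simp: strict_mono_Suc_iff)
qed

lemma bounded_convergent_subseq:
  fixes u :: "nat \<Rightarrow> 'a::euclidean_space"
  assumes "\<And>n. norm (u n) \<le> B"
  obtains l r where "strict_mono r" "(\<lambda>n. u (r n)) \<longlonglongrightarrow> l"
proof -
  have "bounded (range u)"
    using assms by (auto simp: bounded_iff)
  then show thesis
    using bounded_imp_convergent_subsequence[of u] that by (auto simp: o_def)
qed

text \<open>Compactness gives one cluster value; staying away from it infinitely often gives a
  second. The sequence then returns infinitely often below the first third and above the second
  third of the gap between them.\<close>

lemma not_convergent_oscillates:
  fixes u :: "nat \<Rightarrow> real"
  assumes bdd: "\<And>n. \<bar>u n\<bar> \<le> B" and nc: "\<not> convergent u"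
  obtains a b where "a < b" "\<And>N. \<exists>k\<ge>N. u k < a" "\<And>N. \<exists>k\<ge>N. u k > b"
proof -
  obtain l r where r: "strict_mono r" "(\<lambda>n. u (r n)) \<longlonglongrightarrow> l"
    by (rule bounded_convergent_subseq[of u B]) (use bdd in auto)
  have "\<not> u \<longlonglongrightarrow> l" using nc by (auto simp: convergent_def)
  then obtain e where e: "e > 0" "\<And>N. \<exists>k\<ge>N. \<bar>u k - l\<bar> \<ge> e"
    unfolding LIMSEQ_iff real_norm_def by (meson not_le)
  obtain s :: "nat \<Rightarrow> nat" where s: "strict_mono s" "\<And>n. \<bar>u (s n) - l\<bar> \<ge> e"
    using strict_mono_choice[of "\<lambda>n k. \<bar>u k - l\<bar> \<ge> e", OF e(2)] by blast
  obtain l' q where q: "strict_mono q" "(\<lambda>n. u (s (q n))) \<longlonglongrightarrow> l'"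
    by (rule bounded_convergent_subseq[of "\<lambda>n. u (s n)" B]) (use bdd in auto)
  have sq: "strict_mono (\<lambda>n. s (q n))"
    using strict_mono_o[OF s(1) q(1)] by (simp add: o_def)
  have "(\<lambda>n. \<bar>u (s (q n)) - l\<bar>) \<longlonglongrightarrow> \<bar>l' - l\<bar>"
    by (intro tendsto_intros q)
  then have "e \<le> \<bar>l' - l\<bar>"
    by (rule LIMSEQ_le_const) (use s(2) in auto)
  then have "l' \<noteq> l" using e by auto
  have *: "\<exists>a b. a < b \<and> (\<forall>N. \<exists>k\<ge>N. u k < a) \<and> (\<forall>N. \<exists>k\<ge>N. u k > b)"
    if "x < y" "strict_mono p" "(\<lambda>n. u (p n)) \<longlonglongrightarrow> x" "strict_mono p'" "(\<lambda>n. u (p' n)) \<longlonglongrightarrow> y" for x y p p'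
  proof (rule exI[of _ "x + (y - x) / 3"], rule exI[of _ "y - (y - x) / 3"], intro conjI allI)
    fix N
    have "\<forall>\<^sub>F n in sequentially. u (p n) < x + (y - x) / 3"
      using that(1) by (intro order_tendstoD[OF that(3)]) auto
    then obtain n where "n \<ge> N" "u (p n) < x + (y - x) / 3"
      by (metis (mono_tags, lifting) eventually_sequentially nle_le)
    then show "\<exists>k\<ge>N. u k < x + (y - x) / 3"
      using seq_suble[OF that(2), of n] by (intro exI[of _ "p n"]) auto
    have "\<forall>\<^sub>F n in sequentially. u (p' n) > y - (y - x) / 3"
      using that(1) by (intro order_tendstoD[OF that(5)]) auto
    then obtain n where "n \<ge> N" "u (p' n) > y - (y - x) / 3"
      by (metis (mono_tags, lifting) eventually_sequentially nle_le)
    then show "\<exists>k\<ge>N. u k > y - (y - x) / 3"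
      using seq_suble[OF that(4), of n] by (intro exI[of _ "p' n"]) auto
  qed (use that(1) in \<open>simp add: field_simps\<close>)
  show thesis
  proof (cases "l < l'")
    case True
    from *[OF True r sq q(2)] show ?thesis using that by blast
  next
    case False
    then have "l' < l" using \<open>l' \<noteq> l\<close> by simp
    from *[OF this sq q(2) r] show ?thesis using that by blast
  qed
qed

text \<open>\<open>graph_limit\<close> stands in for \<open>g k \<in> G (Z k)\<close>: the
  directions of the algorithm are taken at perturbed points and belong to values of \<open>G\<close>
  only after passage to the limit.\<close>

locale euler_scheme =
  fixes Z g :: "nat \<Rightarrow> 'a::euclidean_space"
    and \<eta> :: "nat \<Rightarrow> real"
    and G :: "'a \<Rightarrow> 'a set"
    and B C :: real
  assumes step: "Z (Suc k) = Z k - \<eta> k *\<^sub>R g k"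
    and step_nonneg: "\<eta> k \<ge> 0"
    and step_lim: "\<eta> \<longlonglongrightarrow> 0"
    and step_sum: "\<not> summable \<eta>"
    and Z_bound: "norm (Z k) \<le> B"
    and g_bound: "norm (g k) \<le> C"
    and graph_limit: "strict_mono r \<Longrightarrow> (\<lambda>j. Z (r j)) \<longlonglongrightarrow> z \<Longrightarrow> (\<lambda>j. g (r j)) \<longlonglongrightarrow> d \<Longrightarrow> d \<in> G z"
    and G_convex: "convex (G z)"
    and G_closed: "closed (G z)"
begin

section \<open>Time scale, interpolation and limit curves of the scheme\<close>

lemma C_nonneg: "C \<ge> 0"
  using g_bound[of 0] norm_ge_zero order_trans by blast

definition T :: "nat \<Rightarrow> real" where "T n = (\<Sum>i<n. \<eta> i)"

lemma T_0 [simp]: "T 0 = 0" and T_Suc: "T (Suc n) = T n + \<eta> n"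
  by (auto simp: T_def)

lemma T_mono: "m \<le> n \<Longrightarrow> T m \<le> T n"
  by (rule lift_Suc_mono_le[of T]) (auto simp: T_Suc step_nonneg)

lemma T_nonneg [simp]: "T n \<ge> 0"
  using T_mono[of 0 n] by simp

lemma T_unbounded: "\<exists>n. T n > M"
proof (rule ccontr)
  assume "\<not> ?thesis"
  then have "summable \<eta>"
    by (intro summableI_nonneg_bounded[of \<eta> M]) (auto simp: step_nonneg T_def[symmetric] not_less)
  with step_sum show False by simp
qed

text \<open>For \<open>t \<ge> 0\<close> this is the last \<open>n\<close> with
  \<open>T n \<le> t\<close>; when zero steps make nodes coincide, comparing with
  \<open>T (Suc n)\<close> selects the last of them.\<close>

definition idx :: "real \<Rightarrow> nat" where "idx t = (LEAST n. t < T (Suc n))"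

lemma less_T_Suc_idx: "t < T (Suc (idx t))"
proof -
  obtain n where "T n > t" using T_unbounded by blast
  then have "t < T (Suc n)" using T_mono[of n "Suc n"] by simp
  then show ?thesis unfolding idx_def by (rule LeastI)
qed

lemma T_idx_le: "t \<ge> 0 \<Longrightarrow> T (idx t) \<le> t"
proof (cases "idx t")
  case (Suc m)
  then have "\<not> t < T (Suc m)"
    unfolding idx_def by (intro not_less_Least) simp
  then show ?thesis using Suc by simp
qed simp

lemma le_idx: "T k \<le> t \<Longrightarrow> k \<le> idx t"
  using less_T_Suc_idx[of t] T_mono[of "Suc (idx t)" k] by (meson leD not_less_eq_eq order_less_le_trans)

lemma idx_mono: "0 \<le> s \<Longrightarrow> s \<le> t \<Longrightarrow> idx s \<le> idx t"
  using T_idx_le[of s] by (intro le_idx) auto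

lemma Z_diff: "k \<le> m \<Longrightarrow> Z k - Z m = (\<Sum>i\<in>{k..<m}. \<eta> i *\<^sub>R g i)"
  by (induction m rule: dec_induct) (auto simp: step algebra_simps)

text \<open>The clamped sum stays meaningful when steps with \<open>\<eta> i = 0\<close> make nodes coincide.\<close>
definition interp :: "nat \<Rightarrow> real \<Rightarrow> 'a" where
  "interp m t = Z 0 - (\<Sum>i<m. (max (T i) (min t (T (Suc i))) - T i) *\<^sub>R g i)"

lemma interp_node: "i \<le> m \<Longrightarrow> interp m (T i) = Z i"
proof -
  assume "i \<le> m"
  have "(\<Sum>j<m. (max (T j) (min (T i) (T (Suc j))) - T j) *\<^sub>R g j) = (\<Sum>j<m. if j < i then \<eta> j *\<^sub>R g j else 0)"
  proof (rule sum.cong[OF refl])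
    fix j
    show "(max (T j) (min (T i) (T (Suc j))) - T j) *\<^sub>R g j = (if j < i then \<eta> j *\<^sub>R g j else 0)"
      using T_mono[of "Suc j" i] T_mono[of i j] step_nonneg[of j]
      by (cases "j < i") (auto simp: T_Suc min_def max_def)
  qed
  also have "\<dots> = (\<Sum>j\<in>{0..<i}. \<eta> j *\<^sub>R g j)"
    using \<open>i \<le> m\<close> by (intro sum.mono_neutral_cong_right) auto
  also have "\<dots> = Z 0 - Z i" by (simp add: Z_diff)
  finally show ?thesis by (simp add: interp_def)
qed

text \<open>The clamped pieces are the overlaps of \<open>{0..t}\<close> with the step intervals,
  which tile \<open>{0..T m}\<close>.\<close>

lemma sum_clamp: "(\<Sum>i<m. max (T i) (min t (T (Suc i))) - T i) = max 0 (min t (T m))"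
proof (induction m)
  case (Suc m)
  have "max 0 (min t (T m)) + (max (T m) (min t (T (Suc m))) - T m) = max 0 (min t (T (Suc m)))"
    using T_mono[of m "Suc m"] T_nonneg[of m] by (auto simp: max_def min_def simp del: T_nonneg)
  then show ?case by (simp add: Suc)
qed auto

lemma interp_lipschitz: "norm (interp m t - interp m s) \<le> C * \<bar>t - s\<bar>"
proof (induction s t rule: linorder_wlog)
  case (le s t)
  let ?c = "\<lambda>i t. max (T i) (min t (T (Suc i)))"
  have "interp m s - interp m t = (\<Sum>i<m. (?c i t - ?c i s) *\<^sub>R g i)"
    by (simp add: interp_def sum_subtractf[symmetric] scaleR_left_diff_distrib[symmetric])
  also have "norm \<dots> \<le> (\<Sum>i<m. (?c i t - ?c i s) * C)"
    using le by (intro sum_norm_le) (auto intro!: mult_mono g_bound)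
  also have "\<dots> = ((\<Sum>i<m. ?c i t - T i) - (\<Sum>i<m. ?c i s - T i)) * C"
    by (simp add: sum_subtractf[symmetric] sum_distrib_right)
  also have "\<dots> = (max 0 (min t (T m)) - max 0 (min s (T m))) * C"
    by (simp only: sum_clamp)
  also have "\<dots> \<le> (t - s) * C"
    using le C_nonneg by (intro mult_right_mono) auto
  finally show ?case using le by (simp add: norm_minus_commute mult.commute)
next
  case (sym s t)
  then show ?case by (simp add: norm_minus_commute abs_minus_commute)
qed

text \<open>A local form of upper semicontinuity. Violations arbitrarily late and arbitrarily close
  to \<open>z\<close> would, the directions being bounded, have a convergent subsequence whose limit
  lies in \<open>G z\<close> on the wrong side. The bound \<open>K\<close> on the index reflects
  that the inclusion is only asymptotic.\<close>

lemma halfspace_near: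
  assumes "\<And>d. d \<in> G z \<Longrightarrow> a \<bullet> d > b"
  obtains \<delta> K where "\<delta> > 0" "\<And>k. k \<ge> K \<Longrightarrow> norm (Z k - z) < \<delta> \<Longrightarrow> a \<bullet> g k \<ge> b"
proof (rule ccontr)
  note near = that
  assume "\<not> thesis"
  then have *: "\<exists>k\<ge>K. norm (Z k - z) < \<delta> \<and> a \<bullet> g k < b" if "\<delta> > 0" for \<delta> K
    using near[OF that, of K] by (meson not_le)
  obtain r where r: "strict_mono r" "\<And>n. norm (Z (r n) - z) < inverse (real (Suc n)) \<and> a \<bullet> g (r n) < b"
    using strict_mono_choice[of "\<lambda>n k. norm (Z k - z) < inverse (real (Suc n)) \<and> a \<bullet> g k < b"] *
    by (metis inverse_positive_iff_positive of_nat_0_less_iff zero_less_Suc)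
  obtain d q where q: "strict_mono q" "(\<lambda>n. g (r (q n))) \<longlonglongrightarrow> d"
    by (rule bounded_convergent_subseq[of "\<lambda>n. g (r n)" C]) (use g_bound in auto)
  have "(\<lambda>n. Z (r n) - z) \<longlonglongrightarrow> 0"
    by (rule LIMSEQ_norm_0) (use r(2) in \<open>auto simp: inverse_eq_divide less_imp_le\<close>)
  then have "(\<lambda>n. Z (r n)) \<longlonglongrightarrow> z"
    by (simp add: LIM_zero_iff)
  then have "(\<lambda>n. Z (r (q n))) \<longlonglongrightarrow> z"
    using LIMSEQ_subseq_LIMSEQ[OF _ q(1)] by (force simp: o_def)
  then have "d \<in> G z"
    using graph_limit[of "\<lambda>n. r (q n)" z d] strict_mono_o[OF r(1) q(1)] q(2) by (simp add: o_def)
  moreover have "(\<lambda>n. a \<bullet> g (r (q n))) \<longlonglongrightarrow> a \<bullet> d"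
    by (intro tendsto_intros q)
  then have "a \<bullet> d \<le> b"
    by (rule LIMSEQ_le_const2) (use r(2) in \<open>auto intro: less_imp_le\<close>)
  ultimately show False using assms by fastforce
qed

text \<open>Rounding a time down to a node costs at most the current step size, which tends to
  zero.\<close>

lemma idx_limit:
  assumes "strict_mono q" "s \<ge> 0"
  shows "filterlim (\<lambda>j. idx (T (q j) + s)) sequentially sequentially"
    and "(\<lambda>j. T (idx (T (q j) + s)) - T (q j)) \<longlonglongrightarrow> s"
proof -
  have ge: "j \<le> idx (T (q j) + s)" for j
    using le_idx[of "q j" "T (q j) + s"] seq_suble[OF assms(1), of j] assms(2) by simp
  show lim: "filterlim (\<lambda>j. idx (T (q j) + s)) sequentially sequentially"
    by (rule filterlim_at_top_mono[OF filterlim_ident]) (use ge in auto)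
  have "(\<lambda>j. \<eta> (idx (T (q j) + s))) \<longlonglongrightarrow> 0"
    by (rule filterlim_compose[OF step_lim lim])
  then have "(\<lambda>j. T (idx (T (q j) + s)) - T (q j) - s) \<longlonglongrightarrow> 0"
  proof (rule Lim_null_comparison[rotated], intro always_eventually allI)
    fix j
    show "norm (T (idx (T (q j) + s)) - T (q j) - s) \<le> \<eta> (idx (T (q j) + s))"
      using less_T_Suc_idx[of "T (q j) + s"] T_idx_le[of "T (q j) + s"] assms(2) by (simp add: T_Suc)
  qed
  then show "(\<lambda>j. T (idx (T (q j) + s)) - T (q j)) \<longlonglongrightarrow> s"
    by (simp add: LIM_zero_iff)
qed

text \<open>At a point of differentiability the difference quotients of the limit curve are limits of averages of
  \<open>- g\<close>, so a separating hyperplane shows that its derivative obeys the inclusion.\<close>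
theorem limit_curve:
  assumes r: "strict_mono r" and lim_r: "(\<lambda>j. Z (r j)) \<longlonglongrightarrow> z" and \<tau>: "\<tau> > 0"
  obtains \<rho> \<zeta> where "strict_mono \<rho>" "C-lipschitz_on UNIV \<zeta>" "\<zeta> 0 = z"
    "\<And>t e. 0 < t \<Longrightarrow> t < \<tau> \<Longrightarrow> (\<zeta> has_vector_derivative e) (at t) \<Longrightarrow> - e \<in> G (\<zeta> t)"
    "\<And>\<epsilon>. \<epsilon> > 0 \<Longrightarrow> \<exists>J. \<forall>j\<ge>J. \<forall>i\<ge>r (\<rho> j). T i \<le> T (r (\<rho> j)) + \<tau> \<longrightarrow>
        norm (Z i - \<zeta> (T i - T (r (\<rho> j)))) < \<epsilon>"
    "\<And>s. 0 \<le> s \<Longrightarrow> s \<le> \<tau> \<Longrightarrow> (\<lambda>j. Z (idx (T (r (\<rho> j)) + s))) \<longlonglongrightarrow> \<zeta> s"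
proof -
  \<comment> \<open>An interpolation with \<open>m j\<close> steps is constant after
    \<open>T (m j)\<close>; placing that node beyond the window keeps it faithful to the iterates
    throughout the window.\<close>
  have "\<forall>j. \<exists>n. T n > T (r j) + \<tau>"
    using T_unbounded by blast
  then obtain m where m: "\<And>j. T (m j) > T (r j) + \<tau>"
    by metis
  have le_m: "i \<le> m j" if "T i \<le> T (r j) + \<tau>" for i j
    using m[of j] that T_mono[of "m j" i] by (metis leD leI less_imp_le order_less_le_trans)
  define F where "F j s = interp (m j) (T (r j) + s)" for j s
  have F_node: "F j (T i - T (r j)) = Z i" if "T i \<le> T (r j) + \<tau>" for i j
    using le_m[OF that] by (simp add: F_def interp_node)
  have F_lip: "norm (F j s - F j t) \<le> C * \<bar>s - t\<bar>" for j s t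
    using interp_lipschitz[of "m j" "T (r j) + s" "T (r j) + t"] by (simp add: F_def)
  have F_0: "F j 0 = Z (r j)" for j
    using F_node[of "r j" j] \<tau> by simp
  \<comment> \<open>All windows start at points of norm at most \<open>B\<close> and share the
    Lipschitz constant \<open>C\<close>, which gives both the uniform bound and
    equicontinuity.\<close>
  obtain \<gamma> and \<rho> :: "nat \<Rightarrow> nat" where \<rho>: "strict_mono \<rho>"
    and unif: "\<And>e. 0 < e \<Longrightarrow> \<exists>N. \<forall>n x. n \<ge> N \<and> x \<in> {0..\<tau>} \<longrightarrow> norm (F (\<rho> n) x - \<gamma> x) < e"
  proof (rule Arzela_Ascoli[of "{0..\<tau>}" F "B + C * \<tau>"])
    show "norm (F n x) \<le> B + C * \<tau>" if "x \<in> {0..\<tau>}" for n x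
    proof -
      have "norm (F n x) \<le> norm (F n 0) + norm (F n x - F n 0)"
        by (metis add.commute diff_add_cancel norm_triangle_ineq)
      also have "\<dots> \<le> B + C * \<bar>x - 0\<bar>"
        using F_lip[of n x 0] Z_bound[of "r n"] by (simp add: F_0)
      also have "\<dots> \<le> B + C * \<tau>"
        using that C_nonneg by (auto intro!: mult_left_mono)
      finally show ?thesis .
    qed
    show "\<exists>d>0. \<forall>n y. y \<in> {0..\<tau>} \<and> norm (x - y) < d \<longrightarrow> norm (F n x - F n y) < e"
      if "e > 0" for x e
    proof (intro exI[of _ "e / (C + 1)"] conjI allI impI)
      show "e / (C + 1) > 0" using that C_nonneg by simp
      fix n y assume y: "y \<in> {0..\<tau>} \<and> norm (x - y) < e / (C + 1)"
      have "norm (F n x - F n y) \<le> (C + 1) * \<bar>x - y\<bar>"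
        using F_lip[of n x y] by (auto simp: algebra_simps intro: order_trans)
      also have "\<dots> < e"
        using y C_nonneg by (simp add: pos_less_divide_eq mult.commute)
      finally show "norm (F n x - F n y) < e" .
    qed
  qed auto
  have \<gamma>_lim: "(\<lambda>n. F (\<rho> n) s) \<longlonglongrightarrow> \<gamma> s" if "s \<in> {0..\<tau>}" for s
    unfolding LIMSEQ_iff using unif that by blast
  \<comment> \<open>Constant extension makes the curve Lipschitz on the whole line, the form in
    which almost everywhere differentiability is available; the inclusion is claimed only at
    interior times.\<close>
  define \<zeta> where "\<zeta> s = \<gamma> (max 0 (min s \<tau>))" for s
  have \<zeta>_eq: "\<zeta> s = \<gamma> s" if "s \<in> {0..\<tau>}" for s
    using that by (simp add: \<zeta>_def)
  have \<gamma>_lip: "norm (\<gamma> s - \<gamma> t) \<le> C * \<bar>s - t\<bar>" if "s \<in> {0..\<tau>}" "t \<in> {0..\<tau>}" for s t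
  proof (rule LIMSEQ_le_const2)
    show "(\<lambda>n. norm (F (\<rho> n) s - F (\<rho> n) t)) \<longlonglongrightarrow> norm (\<gamma> s - \<gamma> t)"
      by (intro tendsto_intros \<gamma>_lim that)
  qed (use F_lip in auto)
  have \<zeta>_lip: "C-lipschitz_on UNIV \<zeta>"
  proof (rule lipschitz_onI)
    fix s t :: real
    have "dist (\<zeta> s) (\<zeta> t) \<le> C * \<bar>max 0 (min s \<tau>) - max 0 (min t \<tau>)\<bar>"
      unfolding \<zeta>_def dist_norm using \<tau> by (intro \<gamma>_lip) auto
    also have "\<dots> \<le> C * dist s t"
      using C_nonneg by (intro mult_left_mono) (auto simp: dist_real_def)
    finally show "dist (\<zeta> s) (\<zeta> t) \<le> C * dist s t" .
  qed (rule C_nonneg)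
  define q where "q j = r (\<rho> j)" for j
  have q: "strict_mono q"
    using strict_mono_o[OF r \<rho>] by (simp add: q_def[abs_def] o_def)
  have \<zeta>_0: "\<zeta> 0 = z"
  proof (rule LIMSEQ_unique)
    show "(\<lambda>n. Z (q n)) \<longlonglongrightarrow> \<zeta> 0"
      using \<gamma>_lim[of 0] \<tau> by (simp add: F_0 q_def \<zeta>_eq)
    show "(\<lambda>n. Z (q n)) \<longlonglongrightarrow> z"
      using LIMSEQ_subseq_LIMSEQ[OF lim_r \<rho>] by (simp add: q_def o_def)
  qed
  have approx: "\<exists>J. \<forall>j\<ge>J. \<forall>i\<ge>q j. T i \<le> T (q j) + \<tau> \<longrightarrow> norm (Z i - \<zeta> (T i - T (q j))) < \<epsilon>"
    if \<epsilon>: "\<epsilon> > 0" for \<epsilon>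
  proof -
    obtain J where J: "\<And>n x. n \<ge> J \<Longrightarrow> x \<in> {0..\<tau>} \<Longrightarrow> norm (F (\<rho> n) x - \<gamma> x) < \<epsilon>"
      using unif[OF \<epsilon>] by blast
    show ?thesis
    proof (intro exI[of _ J] allI impI)
      fix j i assume ji: "j \<ge> J" "i \<ge> q j" "T i \<le> T (q j) + \<tau>"
      then have "T i - T (q j) \<in> {0..\<tau>}" using T_mono[of "q j" i] by auto
      then show "norm (Z i - \<zeta> (T i - T (q j))) < \<epsilon>"
        using J[OF ji(1), of "T i - T (q j)"] F_node[of i "\<rho> j"] ji(3) by (simp add: \<zeta>_eq q_def)
    qed
  qed
  have le_idx_q: "q j \<le> idx (T (q j) + s)" if "s \<ge> 0" for s j
    using that by (intro le_idx) auto
  have T_idx_q: "T (idx (T (q j) + s)) \<le> T (q j) + s" if "s \<ge> 0" for s j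
    using that by (intro T_idx_le) auto
  have sample: "(\<lambda>j. Z (idx (T (q j) + s))) \<longlonglongrightarrow> \<zeta> s" if s: "0 \<le> s" "s \<le> \<tau>" for s
  proof -
    have "(\<lambda>j. Z (idx (T (q j) + s)) - \<zeta> (T (idx (T (q j) + s)) - T (q j))) \<longlonglongrightarrow> 0"
      unfolding LIMSEQ_iff
    proof (intro allI impI)
      fix \<epsilon> :: real assume "\<epsilon> > 0"
      then obtain J where J: "\<And>j i. j \<ge> J \<Longrightarrow> i \<ge> q j \<Longrightarrow> T i \<le> T (q j) + \<tau> \<Longrightarrow> norm (Z i - \<zeta> (T i - T (q j))) < \<epsilon>"
        using approx by blast
      have "norm (Z (idx (T (q j) + s)) - \<zeta> (T (idx (T (q j) + s)) - T (q j)) - 0) < \<epsilon>" if "j \<ge> J" for j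
        using J[OF that le_idx_q[OF s(1)]] T_idx_q[OF s(1), of j] s(2) by simp
      then show "\<exists>J. \<forall>j\<ge>J. norm (Z (idx (T (q j) + s)) - \<zeta> (T (idx (T (q j) + s)) - T (q j)) - 0) < \<epsilon>"
        by blast
    qed
    moreover have "(\<lambda>j. \<zeta> (T (idx (T (q j) + s)) - T (q j))) \<longlonglongrightarrow> \<zeta> s"
      by (rule continuous_on_tendsto_compose[OF lipschitz_on_continuous_on[OF \<zeta>_lip] idx_limit(2)[OF q s(1)]]) auto
    ultimately have "(\<lambda>j. (Z (idx (T (q j) + s)) - \<zeta> (T (idx (T (q j) + s)) - T (q j)))
        + \<zeta> (T (idx (T (q j) + s)) - T (q j))) \<longlonglongrightarrow> 0 + \<zeta> s"
      by (rule tendsto_add)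
    then show ?thesis by simp
  qed
  have incl: "- e \<in> G (\<zeta> t)" if t: "0 < t" "t < \<tau>" and der: "(\<zeta> has_vector_derivative e) (at t)" for t e
  proof (rule ccontr)
    assume "- e \<notin> G (\<zeta> t)"
    then obtain a b where ab: "a \<bullet> (- e) < b" and sep: "\<And>d. d \<in> G (\<zeta> t) \<Longrightarrow> a \<bullet> d > b"
      using separating_hyperplane_closed_point[OF G_convex G_closed] by blast
    obtain \<delta> K where \<delta>: "\<delta> > 0" and near: "\<And>k. k \<ge> K \<Longrightarrow> norm (Z k - \<zeta> t) < \<delta> \<Longrightarrow> a \<bullet> g k \<ge> b"
      using halfspace_near[OF sep] by blast
    \<comment> \<open>The first bound keeps \<open>t + s\<close> inside the window. The second makes
      the curve move by less than \<open>\<delta> / 4\<close> in time \<open>s\<close>; with the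
      approximation error \<open>\<delta> / 4\<close> the iterates involved stay within
      \<open>\<delta>\<close> of \<open>\<zeta> t\<close>.\<close>
    define s0 where "s0 = min (\<tau> - t) (\<delta> / (4 * (C + 1)))"
    have s0: "s0 > 0" using t \<delta> C_nonneg by (simp add: s0_def)
    have quot: "a \<bullet> (\<zeta> t - \<zeta> (t + s)) \<ge> b * s" if s: "0 < s" "s < s0" for s
    proof -
      have Cs: "(C + 1) * s < \<delta> / 4"
      proof -
        have "s < \<delta> / (4 * (C + 1))" using s by (simp add: s0_def)
        then show ?thesis using C_nonneg by (simp add: field_simps)
      qed
      define p where "p j = idx (T (q j) + t)" for j
      define p' where "p' j = idx (T (q j) + (t + s))" for j
      have "(\<lambda>j. a \<bullet> (Z (p j) - Z (p' j)) - b * ((T (p' j) - T (q j)) - (T (p j) - T (q j))))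
          \<longlonglongrightarrow> a \<bullet> (\<zeta> t - \<zeta> (t + s)) - b * ((t + s) - t)"
        unfolding p_def p'_def using t s
        by (intro tendsto_intros sample idx_limit(2)[OF q]) (auto simp: s0_def)
      moreover have "\<forall>\<^sub>F j in sequentially. 0 \<le> a \<bullet> (Z (p j) - Z (p' j)) - b * ((T (p' j) - T (q j)) - (T (p j) - T (q j)))"
      proof -
        obtain J where J: "\<And>j i. j \<ge> J \<Longrightarrow> i \<ge> q j \<Longrightarrow> T i \<le> T (q j) + \<tau> \<Longrightarrow> norm (Z i - \<zeta> (T i - T (q j))) < \<delta> / 4"
          using approx[of "\<delta> / 4"] \<delta> by auto
        have "(\<lambda>j. T (p j) - T (q j)) \<longlonglongrightarrow> t"
          unfolding p_def using t by (intro idx_limit(2)[OF q]) auto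
        \<comment> \<open>Rounding down may place the node of \<open>p j\<close> before time
          \<open>t\<close>. Once the lag is below \<open>s\<close>, all nodes between
          \<open>p j\<close> and \<open>p' j\<close> have relative times within \<open>s\<close> of
          \<open>t\<close>.\<close>
        then have "\<forall>\<^sub>F j in sequentially. t - s < T (p j) - T (q j)"
          using s by (intro order_tendstoD) auto
        moreover have "\<forall>\<^sub>F j in sequentially. j \<ge> max J K"
          by (rule eventually_ge_at_top)
        ultimately show ?thesis
        proof eventually_elim
          case (elim j)
          have pp': "p j \<le> p' j"
            unfolding p_def p'_def using t s by (intro idx_mono) auto
          have qp: "q j \<le> p j"
            unfolding p_def using t by (intro le_idx_q) auto
          have Tp': "T (p' j) \<le> T (q j) + (t + s)"
            unfolding p'_def using t s by (intro T_idx_q) auto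
          have g_ge: "a \<bullet> g i \<ge> b" if i: "i \<in> {p j..<p' j}" for i
          proof (rule near)
            have iq: "i \<ge> q j" using i qp by auto
            then show "i \<ge> K" using elim(2) seq_suble[OF q, of j] by auto
            have Ti: "T (p j) \<le> T i" "T i \<le> T (p' j)" using i by (auto intro: T_mono)
            have "T i \<le> T (q j) + \<tau>" using Ti(2) Tp' s by (simp add: s0_def)
            then have 1: "norm (Z i - \<zeta> (T i - T (q j))) < \<delta> / 4"
              using J[OF _ iq] elim(2) by simp
            have "norm (\<zeta> (T i - T (q j)) - \<zeta> t) \<le> C * \<bar>T i - T (q j) - t\<bar>"
              using lipschitz_onD[OF \<zeta>_lip, of "T i - T (q j)" t] by (simp add: dist_norm)
            also have "\<dots> \<le> C * s"
              using Ti Tp' elim(1) C_nonneg by (intro mult_left_mono) auto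
            also have "\<dots> < \<delta> / 4"
              using Cs s by (simp add: algebra_simps)
            finally have 2: "norm (\<zeta> (T i - T (q j)) - \<zeta> t) < \<delta> / 4" .
            have "norm (Z i - \<zeta> t) \<le> norm (Z i - \<zeta> (T i - T (q j))) + norm (\<zeta> (T i - T (q j)) - \<zeta> t)"
              by (rule norm_triangle_sub[of "Z i - \<zeta> t" "Z i - \<zeta> (T i - T (q j))", THEN order_trans]) simp
            then show "norm (Z i - \<zeta> t) < \<delta>" using 1 2 \<delta> by linarith
          qed
          have "b * (T (p' j) - T (p j)) = (\<Sum>i\<in>{p j..<p' j}. \<eta> i * b)"
          proof -
            have "(\<Sum>i\<in>{p j..<p' j}. T (Suc i) - T i) = T (p' j) - T (p j)"
              using pp' by (rule sum_Suc_diff')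
            then show ?thesis by (simp add: T_Suc sum_distrib_left[symmetric] mult.commute)
          qed
          also have "\<dots> \<le> (\<Sum>i\<in>{p j..<p' j}. \<eta> i * (a \<bullet> g i))"
            by (intro sum_mono mult_left_mono g_ge step_nonneg)
          also have "\<dots> = a \<bullet> (Z (p j) - Z (p' j))"
            by (simp add: Z_diff[OF pp'] inner_sum_right)
          finally show ?case by simp
        qed
      qed
      ultimately have "0 \<le> a \<bullet> (\<zeta> t - \<zeta> (t + s)) - b * ((t + s) - t)"
        by (rule tendsto_lowerbound) simp
      then show ?thesis by simp
    qed
    have "((\<lambda>s. a \<bullet> - \<zeta> s) has_real_derivative a \<bullet> - e) (at t)"
      using bounded_linear.has_vector_derivative[OF bounded_linear_inner_right has_vector_derivative_minus[OF der], of a]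
      by (simp add: has_real_derivative_iff_has_vector_derivative)
    then have "((\<lambda>h. (a \<bullet> - \<zeta> (t + h) - a \<bullet> - \<zeta> t) / h) \<longlongrightarrow> a \<bullet> - e) (at 0)"
      by (rule DERIV_D)
    then have "((\<lambda>h. (a \<bullet> - \<zeta> (t + h) - a \<bullet> - \<zeta> t) / h) \<longlongrightarrow> a \<bullet> - e) (at_right 0)"
      by (rule tendsto_within_subset) simp
    moreover have "\<forall>\<^sub>F h in at_right 0. b \<le> (a \<bullet> - \<zeta> (t + h) - a \<bullet> - \<zeta> t) / h"
      unfolding eventually_at_right_field
    proof (intro exI[of _ s0] conjI allI impI s0)
      fix h assume h: "0 < h" "h < s0"
      then show "b \<le> (a \<bullet> - \<zeta> (t + h) - a \<bullet> - \<zeta> t) / h"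
        using quot[OF h] by (simp add: pos_le_divide_eq inner_diff_right)
    qed
    ultimately have "b \<le> a \<bullet> - e"
      by (rule tendsto_lowerbound) simp
    with ab show False by simp
  qed
  show thesis
    using \<rho> \<zeta>_lip \<zeta>_0 incl approx sample unfolding q_def by (rule that)
qed

text \<open>If the values oscillate, some \<open>c\<close> outside the critical values is up-crossed infinitely often;
  a limit curve started at the last indices below \<open>c\<close> drops below \<open>c\<close> within a fixed time, before
  the iterates can have climbed further.\<close>
theorem lyapunov_convergence:
  fixes h :: "'a \<Rightarrow> real"
  assumes cont: "continuous_on UNIV h"
    and descent: "\<And>z \<zeta>. 0 \<notin> G z \<Longrightarrow> C-lipschitz_on UNIV \<zeta> \<Longrightarrow> \<zeta> 0 = z \<Longrightarrow>
      (\<And>t e. 0 < t \<Longrightarrow> t < 1 \<Longrightarrow> (\<zeta> has_vector_derivative e) (at t) \<Longrightarrow> - e \<in> G (\<zeta> t)) \<Longrightarrow>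
      \<exists>\<sigma>. 0 < \<sigma> \<and> \<sigma> \<le> 1 \<and> h (\<zeta> \<sigma>) < h z \<and> (\<forall>s\<in>{0..\<sigma>}. h (\<zeta> s) \<le> h z)"
    and crit: "interior (h ` {z. 0 \<in> G z}) = {}"
  shows "convergent (\<lambda>k. h (Z k))"
    and "strict_mono r \<Longrightarrow> (\<lambda>j. Z (r j)) \<longlonglongrightarrow> z \<Longrightarrow> 0 \<in> G z"
proof -
  have h_lim: "(\<lambda>j. h (u j)) \<longlonglongrightarrow> h l" if "u \<longlonglongrightarrow> l" for u :: "nat \<Rightarrow> 'a" and l
    by (rule continuous_on_tendsto_compose[OF cont that]) auto
  show conv: "convergent (\<lambda>k. h (Z k))"
  proof (rule ccontr)
    assume nc: "\<not> convergent (\<lambda>k. h (Z k))"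
    have "bounded (h ` cball 0 B)"
      by (intro compact_imp_bounded compact_continuous_image continuous_on_subset[OF cont]) auto
    then obtain M where "\<And>z. z \<in> cball 0 B \<Longrightarrow> \<bar>h z\<bar> \<le> M"
      unfolding bounded_iff ball_simps real_norm_def by blast
    then have "\<bar>h (Z k)\<bar> \<le> M" for k
      using Z_bound by simp
    then obtain a b where ab: "a < b" and below: "\<And>N. \<exists>k\<ge>N. h (Z k) < a" and above: "\<And>N. \<exists>k\<ge>N. h (Z k) > b"
      using not_convergent_oscillates[OF _ nc] by metis
    have "\<not> {a<..<b} \<subseteq> h ` {z. 0 \<in> G z}"
      using crit ab interior_maximal[of "{a<..<b}"] by (metis dense empty_iff greaterThanLessThan_iff open_greaterThanLessThan subset_empty)
    then obtain c where c: "a < c" "c < b" and c_reg: "\<And>z. h z = c \<Longrightarrow> 0 \<notin> G z"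
      by fastforce
    have up: "\<exists>s\<ge>N. \<exists>t>s. h (Z s) \<le> c \<and> h (Z t) > b \<and> (\<forall>i. s < i \<and> i \<le> t \<longrightarrow> h (Z i) > c)" for N
    proof -
      obtain k where k: "k \<ge> N" "h (Z k) < a" using below by blast
      obtain t where t: "t \<ge> k" "h (Z t) > b" using above by blast
      define S where "S = {i. k \<le> i \<and> i \<le> t \<and> h (Z i) \<le> c}"
      have S: "finite S" "k \<in> S"
        using k t c by (auto simp: S_def intro: finite_subset[of _ "{..t}"])
      define s where "s = Max S"
      have sS: "s \<in> S" unfolding s_def using S by (intro Max_in) auto
      have "h (Z i) > c" if "s < i" "i \<le> t" for i
      proof (rule ccontr)
        assume "\<not> h (Z i) > c"
        then have "i \<in> S" using that sS by (auto simp: S_def)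
        then have "i \<le> s" unfolding s_def using S by (intro Max_ge)
        with that show False by simp
      qed
      moreover have "s \<noteq> t" using sS t c by (auto simp: S_def)
      ultimately show ?thesis
        using sS k t by (intro exI[of _ s] conjI exI[of _ t]) (auto simp: S_def)
    qed
    obtain s :: "nat \<Rightarrow> nat" where s: "strict_mono s"
      and s_up: "\<forall>n. \<exists>t>s n. h (Z (s n)) \<le> c \<and> h (Z t) > b \<and> (\<forall>i. s n < i \<and> i \<le> t \<longrightarrow> h (Z i) > c)"
      using strict_mono_choice[of "\<lambda>n s. \<exists>t>s. h (Z s) \<le> c \<and> h (Z t) > b \<and> (\<forall>i. s < i \<and> i \<le> t \<longrightarrow> h (Z i) > c)", OF up]
      by blast
    then obtain t where t: "\<And>n. s n < t n" "\<And>n. h (Z (s n)) \<le> c" "\<And>n. h (Z (t n)) > b"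
      "\<And>n i. s n < i \<Longrightarrow> i \<le> t n \<Longrightarrow> h (Z i) > c"
      by metis
    obtain z and q :: "nat \<Rightarrow> nat" where q: "strict_mono q" and lim: "(\<lambda>n. Z (s (q n))) \<longlonglongrightarrow> z"
      by (rule bounded_convergent_subseq[of "\<lambda>n. Z (s n)" B]) (use Z_bound in auto)
    define r where "r n = s (q n)" for n
    have r: "strict_mono r"
      using strict_mono_o[OF s q] by (simp add: r_def[abs_def] o_def)
    have lim_r: "(\<lambda>n. Z (r n)) \<longlonglongrightarrow> z" using lim by (simp add: r_def)
    have hz: "h z = c"
    proof (rule antisym)
      show "h z \<le> c"
        by (rule LIMSEQ_le_const2[OF h_lim[OF lim_r]]) (use t(2) in \<open>auto simp: r_def\<close>)
      \<comment> \<open>One step has length at most \<open>\<eta> (r n) * C\<close>, so the first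
        iterate above \<open>c\<close> has the same limit as the last one not above it; this pins
        \<open>h z\<close> to \<open>c\<close>.\<close>
      have "(\<lambda>n. \<eta> (r n)) \<longlonglongrightarrow> 0"
        using LIMSEQ_subseq_LIMSEQ[OF step_lim r] by (simp add: o_def)
      then have "(\<lambda>n. \<eta> (r n) * C) \<longlonglongrightarrow> 0"
        by (rule tendsto_mult_left_zero)
      then have "(\<lambda>n. \<eta> (r n) *\<^sub>R g (r n)) \<longlonglongrightarrow> 0"
        by (rule Lim_null_comparison[rotated]) (auto intro!: always_eventually mult_left_mono simp: g_bound step_nonneg)
      from tendsto_diff[OF lim_r this] have "(\<lambda>n. Z (Suc (r n))) \<longlonglongrightarrow> z"
        by (simp add: step)
      moreover have "c \<le> h (Z (Suc (r n)))" for n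
        using t(4)[of "q n" "Suc (r n)"] t(1)[of "q n"] by (simp add: r_def Suc_le_eq)
      ultimately show "c \<le> h z"
        using LIMSEQ_le_const[OF h_lim] by blast
    qed
    obtain \<rho> \<zeta> where \<rho>: "strict_mono \<rho>" and \<zeta>: "C-lipschitz_on UNIV \<zeta>" "\<zeta> 0 = z"
      "\<And>t e. 0 < t \<Longrightarrow> t < 1 \<Longrightarrow> (\<zeta> has_vector_derivative e) (at t) \<Longrightarrow> - e \<in> G (\<zeta> t)"
      and approx: "\<And>\<epsilon>. \<epsilon> > 0 \<Longrightarrow> \<exists>J. \<forall>j\<ge>J. \<forall>i\<ge>r (\<rho> j). T i \<le> T (r (\<rho> j)) + 1 \<longrightarrow>
        norm (Z i - \<zeta> (T i - T (r (\<rho> j)))) < \<epsilon>"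
      and sample: "\<And>s. 0 \<le> s \<Longrightarrow> s \<le> 1 \<Longrightarrow> (\<lambda>j. Z (idx (T (r (\<rho> j)) + s))) \<longlonglongrightarrow> \<zeta> s"
      using limit_curve[OF r lim_r zero_less_one] by blast
    obtain \<sigma> where \<sigma>: "0 < \<sigma>" "\<sigma> \<le> 1" and lt: "h (\<zeta> \<sigma>) < c" and le: "\<And>s. s \<in> {0..\<sigma>} \<Longrightarrow> h (\<zeta> s) \<le> c"
      using descent[OF c_reg[OF hz] \<zeta>] unfolding hz by blast
    \<comment> \<open>A ball containing all iterates and the curve on the unit interval. Uniform
      continuity of \<open>h\<close> on it is used with tolerance \<open>b - c\<close>, the height
      of the climb to be excluded.\<close>
    define R where "R = max B (norm z + C)"
    have \<zeta>_R: "\<zeta> s \<in> cball 0 R" if "s \<in> {0..1}" for s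
    proof -
      have "norm (\<zeta> s - \<zeta> 0) \<le> C * \<bar>s - 0\<bar>"
        using lipschitz_onD[OF \<zeta>(1), of s 0] by (simp add: dist_norm)
      also have "\<dots> \<le> C" using that C_nonneg by (auto intro: mult_left_le)
      finally show ?thesis
        using norm_triangle_sub[of "\<zeta> s" "\<zeta> 0"] by (auto simp: R_def \<zeta>(2))
    qed
    have "uniformly_continuous_on (cball 0 R) h"
      by (intro compact_uniformly_continuous continuous_on_subset[OF cont]) auto
    then obtain \<epsilon> where \<epsilon>: "\<epsilon> > 0"
      and uc: "\<And>x y. x \<in> cball 0 R \<Longrightarrow> y \<in> cball 0 R \<Longrightarrow> dist y x < \<epsilon> \<Longrightarrow> dist (h y) (h x) < b - c"
      using c(2) unfolding uniformly_continuous_on_def by (metis diff_gt_0_iff_gt)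
    obtain J where J: "\<And>j i. j \<ge> J \<Longrightarrow> i \<ge> r (\<rho> j) \<Longrightarrow> T i \<le> T (r (\<rho> j)) + 1 \<Longrightarrow>
        norm (Z i - \<zeta> (T i - T (r (\<rho> j)))) < \<epsilon>"
      using approx[OF \<epsilon>] by blast
    define n where "n j = idx (T (r (\<rho> j)) + \<sigma>)" for j
    have n_ge: "r (\<rho> j) \<le> n j" for j
      unfolding n_def using \<sigma> by (intro le_idx) auto
    have Tn: "T (n j) \<le> T (r (\<rho> j)) + \<sigma>" for j
      unfolding n_def using \<sigma> by (intro T_idx_le) auto
    \<comment> \<open>Reaching the index \<open>t\<close> within time \<open>\<sigma>\<close> would
      put a value above \<open>b\<close> within \<open>\<epsilon>\<close> of a curve point whose
      value is at most \<open>c\<close>.\<close>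
    have n_less: "n j < t (q (\<rho> j))" if j: "j \<ge> J" for j
    proof (rule ccontr)
      let ?i = "t (q (\<rho> j))"
      assume "\<not> n j < ?i"
      then have Ti: "T ?i \<le> T (r (\<rho> j)) + \<sigma>"
        using T_mono[of ?i "n j"] Tn[of j] by simp
      have ri: "r (\<rho> j) \<le> ?i" using t(1)[of "q (\<rho> j)"] by (simp add: r_def)
      have "norm (Z ?i - \<zeta> (T ?i - T (r (\<rho> j)))) < \<epsilon>"
        using Ti \<sigma> by (intro J[OF j ri]) auto
      moreover have in01: "T ?i - T (r (\<rho> j)) \<in> {0..\<sigma>}" using Ti T_mono[OF ri] by simp
      ultimately have "dist (h (Z ?i)) (h (\<zeta> (T ?i - T (r (\<rho> j))))) < b - c"
        using \<sigma> by (intro uc \<zeta>_R) (auto simp: dist_norm R_def intro: le_max_iff_disj[THEN iffD2] Z_bound)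
      then have "h (Z ?i) < b"
        using le[OF in01] by (auto simp: dist_real_def)
      then show False using t(3)[of "q (\<rho> j)"] by simp
    qed
    have lim1: "(\<lambda>j. h (Z (n j))) \<longlonglongrightarrow> h (\<zeta> \<sigma>)"
      unfolding n_def using \<sigma> by (intro h_lim sample) auto
    \<comment> \<open>\<open>n j\<close> may coincide with the starting index, where the value is at
      most \<open>c\<close> instead of above it. The minimum with \<open>c\<close> covers both cases
      and still tends to \<open>c\<close>, because \<open>h z = c\<close>.\<close>
    have lim2: "(\<lambda>j. min c (h (Z (r (\<rho> j))))) \<longlonglongrightarrow> min c c"
      using LIMSEQ_subseq_LIMSEQ[OF h_lim[OF lim_r] \<rho>] by (intro tendsto_intros) (simp add: o_def hz)
    have "min c c \<le> h (\<zeta> \<sigma>)"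
    proof (rule LIMSEQ_le[OF lim2 lim1])
      have "min c (h (Z (r (\<rho> j)))) \<le> h (Z (n j))" if "j \<ge> J" for j
      proof (cases "n j = r (\<rho> j)")
        case False
        then have "h (Z (n j)) > c"
          using n_ge[of j] n_less[OF that] by (intro t(4)[of "q (\<rho> j)"]) (auto simp: r_def)
        then show ?thesis by simp
      qed simp
      then show "\<exists>N. \<forall>j\<ge>N. min c (h (Z (r (\<rho> j)))) \<le> h (Z (n j))" by blast
    qed
    with lt show False by simp
  qed
  show "0 \<in> G z" if r: "strict_mono r" and lim_r: "(\<lambda>j. Z (r j)) \<longlonglongrightarrow> z"
  proof (rule ccontr)
    assume z: "0 \<notin> G z"
    obtain H where H: "(\<lambda>k. h (Z k)) \<longlonglongrightarrow> H" using conv by (auto simp: convergent_def)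
    have hz: "h z = H"
      using LIMSEQ_unique[OF h_lim[OF lim_r]] LIMSEQ_subseq_LIMSEQ[OF H r] by (simp add: o_def)
    obtain \<rho> \<zeta> where \<rho>: "strict_mono \<rho>" and \<zeta>: "C-lipschitz_on UNIV \<zeta>" "\<zeta> 0 = z"
      "\<And>t e. 0 < t \<Longrightarrow> t < 1 \<Longrightarrow> (\<zeta> has_vector_derivative e) (at t) \<Longrightarrow> - e \<in> G (\<zeta> t)"
      and sample: "\<And>s. 0 \<le> s \<Longrightarrow> s \<le> 1 \<Longrightarrow> (\<lambda>j. Z (idx (T (r (\<rho> j)) + s))) \<longlonglongrightarrow> \<zeta> s"
      using limit_curve[OF r lim_r zero_less_one] by blast
    obtain \<sigma> where \<sigma>: "0 < \<sigma>" "\<sigma> \<le> 1" and lt: "h (\<zeta> \<sigma>) < h z"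
      using descent[OF z \<zeta>] by blast
    have q: "strict_mono (\<lambda>j. r (\<rho> j))"
      using strict_mono_o[OF r \<rho>] by (simp add: o_def)
    have "(\<lambda>j. h (Z (idx (T (r (\<rho> j)) + \<sigma>)))) \<longlonglongrightarrow> H"
      using filterlim_compose[OF H idx_limit(1)[OF q less_imp_le[OF \<sigma>(1)]]] by simp
    moreover have "(\<lambda>j. h (Z (idx (T (r (\<rho> j)) + \<sigma>)))) \<longlonglongrightarrow> h (\<zeta> \<sigma>)"
      using \<sigma> by (intro h_lim sample) auto
    ultimately have "h (\<zeta> \<sigma>) = H" using LIMSEQ_unique by blast
    with lt hz show False by simp
  qed
qed

end

section \<open>The bilevel problem\<close>

lemma has_derivative_norm_bound:
  assumes lip: "\<And>z'. norm (F z' - F z) \<le> L * norm (z' - z)"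
    and der: "(F has_derivative D) (at z)"
  shows "norm (D k) \<le> L * norm k"
proof (cases "k = 0")
  case False
  interpret D: bounded_linear D
    using der by (rule has_derivative_bounded_linear)
  have "norm (D k) \<le> L * norm k + e" if e: "e > 0" for e
  proof -
    define e' where "e' = e / norm k"
    have e': "e' > 0" "e' * norm k = e" using e False by (auto simp: e'_def)
    obtain d where d: "d > 0" and est: "\<And>y. norm (y - z) < d \<Longrightarrow> norm (F y - F z - D (y - z)) \<le> e' * norm (y - z)"
      using der e'(1) unfolding has_derivative_at_alt by blast
    define t where "t = d / (2 * norm k)"
    have t: "t > 0" "norm (t *\<^sub>R k) < d" using d False by (auto simp: t_def)
    have "t * norm (D k) = norm (D (t *\<^sub>R k))" using t by (simp add: D.scaleR)
    also have "\<dots> \<le> norm (F (z + t *\<^sub>R k) - F z) + norm (F (z + t *\<^sub>R k) - F z - D (t *\<^sub>R k))"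
      using norm_triangle_ineq4[of "F (z + t *\<^sub>R k) - F z" "F (z + t *\<^sub>R k) - F z - D (t *\<^sub>R k)"] by simp
    also have "\<dots> \<le> L * norm (t *\<^sub>R k) + e' * norm (t *\<^sub>R k)"
      using lip[of "z + t *\<^sub>R k"] est[of "z + t *\<^sub>R k"] t(2) by (intro add_mono) auto
    also have "\<dots> = t * (L * norm k + e)"
      using t(1) e'(2) by (simp add: algebra_simps)
    finally show ?thesis using t(1) by simp
  qed
  then show ?thesis by (rule field_le_epsilon)
qed (use has_derivative_bounded_linear[OF der] in \<open>simp add: linear_0 bounded_linear.linear\<close>)

lemma has_derivative_zero_if_quadratic:
  assumes "\<And>z'. norm (E z') \<le> K * (norm (z' - z))\<^sup>2"
  shows "(E has_derivative (\<lambda>_. 0)) (at z)"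
  unfolding has_derivative_at_alt
proof (intro conjI allI impI)
  fix e :: real assume e: "e > 0"
  have E0: "E z = 0" using assms[of z] by simp
  show "\<exists>d>0. \<forall>y. norm (y - z) < d \<longrightarrow> norm (E y - E z - 0) \<le> e * norm (y - z)"
  proof (intro exI[of _ "e / (\<bar>K\<bar> + 1)"] conjI allI impI)
    fix y assume y: "norm (y - z) < e / (\<bar>K\<bar> + 1)"
    have "norm (E y) \<le> K * (norm (y - z))\<^sup>2" by (rule assms)
    also have "\<dots> \<le> ((\<bar>K\<bar> + 1) * norm (y - z)) * norm (y - z)"
      by (auto simp: power2_eq_square mult.assoc intro!: mult_right_mono)
    also have "\<dots> \<le> e * norm (y - z)"
      using y by (intro mult_right_mono) (auto simp: field_simps)
    finally show "norm (E y - E z - 0) \<le> e * norm (y - z)" by (simp add: E0)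
  qed (use e in auto)
qed simp

lemma inner_transpose_matrix_vector:
  fixes A :: "real^'m^'k"
  shows "(transpose A *v a) \<bullet> b = a \<bullet> (A *v b)"
  by (metis dot_lmul_matrix transpose_matrix_vector)

lemma norm_matrix_vector_mult_le_opnorm: "norm (A *v u) \<le> opnorm A * norm u"
  unfolding opnorm_def by (rule onorm) (rule matrix_vector_mul_bounded_linear)

lemma invertible_matrix_inv_cancel:
  fixes A :: "real^'m^'m"
  assumes "invertible A"
  shows "A *v (matrix_inv A *v u) = u" "matrix_inv A *v (A *v u) = u"
proof -
  have "\<exists>A'. A ** A' = mat 1 \<and> A' ** A = mat 1"
    using assms by (simp add: invertible_def)
  then have "A ** matrix_inv A = mat 1 \<and> matrix_inv A ** A = mat 1"
    unfolding matrix_inv_def by (rule someI_ex)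
  then show "A *v (matrix_inv A *v u) = u" "matrix_inv A *v (A *v u) = u"
    by (simp_all add: matrix_vector_mul_assoc)
qed

lemma lipschitz_imp_abs_cont_curve:
  assumes "L-lipschitz_on UNIV \<gamma>"
  shows "abs_cont_curve \<gamma>"
  unfolding abs_cont_curve_def
proof (intro allI impI)
  fix \<epsilon> :: real assume \<epsilon>: "\<epsilon> > 0"
  have L: "L \<ge> 0" using assms by (rule lipschitz_on_nonneg)
  show "\<exists>\<delta>>0. \<forall>(n::nat) (a::nat \<Rightarrow> real) (b::nat \<Rightarrow> real).
        (\<forall>i<n. 0 \<le> a i \<and> a i \<le> b i \<and> b i \<le> 1) \<longrightarrow>
        (\<forall>i<n. \<forall>j<n. i \<noteq> j \<longrightarrow> b i \<le> a j \<or> b j \<le> a i) \<longrightarrow>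
        (\<Sum>i<n. b i - a i) < \<delta> \<longrightarrow>
        (\<Sum>i<n. norm (\<gamma> (b i) - \<gamma> (a i))) < \<epsilon>"
  proof (intro exI[of _ "\<epsilon> / (L + 1)"] conjI allI impI)
    fix n :: nat and a b :: "nat \<Rightarrow> real"
    assume ab: "\<forall>i<n. 0 \<le> a i \<and> a i \<le> b i \<and> b i \<le> 1" and sum: "(\<Sum>i<n. b i - a i) < \<epsilon> / (L + 1)"
    have "(\<Sum>i<n. norm (\<gamma> (b i) - \<gamma> (a i))) \<le> (\<Sum>i<n. (L + 1) * (b i - a i))"
    proof (rule sum_mono)
      fix i assume "i \<in> {..<n}"
      then have i: "a i \<le> b i" using ab by auto
      have "norm (\<gamma> (b i) - \<gamma> (a i)) \<le> L * (b i - a i)"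
        using lipschitz_onD[OF assms, of "b i" "a i"] i by (simp add: dist_norm)
      then show "norm (\<gamma> (b i) - \<gamma> (a i)) \<le> (L + 1) * (b i - a i)"
        using i by (simp add: algebra_simps)
    qed
    also have "\<dots> < \<epsilon>"
      using sum L by (simp add: sum_distrib_left[symmetric] pos_less_divide_eq mult.commute)
    finally show "(\<Sum>i<n. norm (\<gamma> (b i) - \<gamma> (a i))) < \<epsilon>" .
  qed (use \<epsilon> L in auto)
qed

lemma has_integral_ge_const_AE:
  fixes F :: "real \<Rightarrow> real"
  assumes int: "(F has_integral I) {a..b}" and "a \<le> b"
    and ae: "AE t in lborel. a < t \<and> t < b \<longrightarrow> c \<le> F t"
  shows "c * (b - a) \<le> I"
proof -
  obtain N where N: "N \<in> null_sets lborel" "{t. \<not> (a < t \<and> t < b \<longrightarrow> c \<le> F t)} \<subseteq> N"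
    using ae by (auto simp: eventually_ae_filter)
  have "N \<in> null_sets lebesgue"
    using N(1) by (rule null_sets_completionI)
  then have neg: "negligible (N \<union> {a, b})"
    by (simp add: negligible_iff_null_sets)
  \<comment> \<open>Overwriting the integrand by \<open>c\<close> on the exceptional null set and at
    the endpoints makes the bound hold everywhere without changing the integral.\<close>
  have int': "((\<lambda>t. if t \<in> N \<union> {a, b} then c else F t) has_integral I) {a..b}"
    by (rule has_integral_spike[OF neg _ int]) auto
  have "((\<lambda>t. c) has_integral c * (b - a)) {a..b}"
    using has_integral_const_real[of c a b] \<open>a \<le> b\<close> by (simp add: mult.commute)
  then show ?thesis
  proof (rule has_integral_le[OF _ int'])
    fix t assume "t \<in> {a..b}"
    then have "t \<in> N \<union> {a, b} \<or> c \<le> F t"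
      using N(2) by force
    then show "c \<le> (if t \<in> N \<union> {a, b} then c else F t)" by auto
  qed
qed

locale bilevel =
  fixes f g :: "((real^'n) \<times> (real^'p)) \<Rightarrow> real"
    and Gx :: "((real^'n) \<times> (real^'p)) \<Rightarrow> real^'n"
    and Gy :: "((real^'n) \<times> (real^'p)) \<Rightarrow> real^'p"
    and Hyy :: "((real^'n) \<times> (real^'p)) \<Rightarrow> real^'p^'p"
    and Hxy :: "((real^'n) \<times> (real^'p)) \<Rightarrow> real^'p^'n"
    and DH :: "((real^'n) \<times> (real^'p)) \<Rightarrow> ((real^'n) \<times> (real^'p)) \<Rightarrow> real^'p^'p"
    and Df :: "((real^'n) \<times> (real^'p)) \<Rightarrow> (((real^'n) \<times> (real^'p))) set"
    and Mf \<mu> Lg Qg \<beta> \<beta>h :: real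
  assumes pos_consts: "Mf > 0" "\<mu> > 0" "Lg > 0" "Qg > 0"
    and f_lip: "Mf-lipschitz_on UNIV f"
    and g_grad: "\<And>z. (g has_derivative (\<lambda>(a, b). Gx z \<bullet> a + Gy z \<bullet> b)) (at z)"
    and Gx_diff: "\<And>z. Gx differentiable (at z)"
    and Gy_deriv: "\<And>z. (Gy has_derivative (\<lambda>(a, b). transpose (Hxy z) *v a + Hyy z *v b)) (at z)"
    and Hyy_pd: "\<And>z u. u \<bullet> (Hyy z *v u) \<ge> \<mu> * (norm u)\<^sup>2"
    and grad_lip: "Lg-lipschitz_on UNIV (\<lambda>z. (Gx z, Gy z))"
    and Hyy_lip: "\<And>z z'. opnorm (Hyy z - Hyy z') \<le> Qg * norm (z - z')"
    and Hxy_lip: "\<And>z z'. opnorm (Hxy z - Hxy z') \<le> Qg * norm (z - z')"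
    and Hyy_deriv: "\<And>z. (Hyy has_derivative DH z) (at z)"
    and f_pot: "potential_of f Df"
    and Df_vals: "\<And>z. convex (Df z) \<and> compact (Df z) \<and> (\<forall>d \<in> Df z. norm d \<le> Mf)"
    and beta: "\<beta> \<ge> 4 * Qg * Mf / \<mu> ^ 3"
    and betah: "\<beta>h \<ge> \<beta> * Max {8 * Lg\<^sup>2 / \<mu>, 1 / (4 * \<mu>), \<mu> / 4}"
begin

declare transpose_matrix_vector [simp del]

section \<open>Bounds for the second derivatives and the inverse Hessian\<close>

definition GyD :: "((real^'n) \<times> (real^'p)) \<Rightarrow> ((real^'n) \<times> (real^'p)) \<Rightarrow> real^'p" where
  "GyD z k = transpose (Hxy z) *v fst k + Hyy z *v snd k"

lemma Gy_has_derivative: "(Gy has_derivative GyD z) (at z)"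
  using Gy_deriv[of z] by (simp add: GyD_def[abs_def] case_prod_beta')

lemma Gy_lip: "norm (Gy z - Gy z') \<le> Lg * norm (z - z')"
proof -
  have "norm (Gy z - Gy z') \<le> norm ((Gx z, Gy z) - (Gx z', Gy z'))"
    using norm_snd_le[of "Gy z - Gy z'" "Gx z - Gx z'"] by simp
  also have "\<dots> \<le> Lg * norm (z - z')"
    using lipschitz_onD[OF grad_lip, of z z'] by (simp add: dist_norm)
  finally show ?thesis .
qed

lemma GyD_bound: "norm (GyD z k) \<le> Lg * norm k"
  by (rule has_derivative_norm_bound[OF Gy_lip Gy_has_derivative])

lemma transpose_Hxy_bound: "norm (transpose (Hxy z) *v a) \<le> Lg * norm a"
  using GyD_bound[of z "(a, 0)"] by (simp add: GyD_def norm_Pair)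

text \<open>A matrix and its transpose have the same norm: the bound for the transpose is tested at
  \<open>Hxy z *v b\<close>.\<close>

lemma Hxy_bound: "norm (Hxy z *v b) \<le> Lg * norm b"
proof (cases "Hxy z *v b = 0")
  case False
  let ?u = "Hxy z *v b"
  have "norm ?u * norm ?u = (transpose (Hxy z) *v ?u) \<bullet> b"
    by (simp add: inner_transpose_matrix_vector dot_square_norm power2_eq_square)
  also have "\<dots> \<le> norm (transpose (Hxy z) *v ?u) * norm b"
    by (rule norm_cauchy_schwarz)
  also have "\<dots> \<le> (Lg * norm ?u) * norm b"
    by (intro mult_right_mono transpose_Hxy_bound) auto
  finally have "norm ?u * norm ?u \<le> (Lg * norm b) * norm ?u" by (simp add: mult_ac)
  then show ?thesis using False by simp
qed (use pos_consts in simp)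

lemma Hyy_bound: "norm (Hyy z *v b) \<le> Lg * norm b"
  using GyD_bound[of z "(0, b)"] by (simp add: GyD_def norm_Pair)

text \<open>\<open>Hyy\<close> is given only as a block of the derivative of \<open>Gy\<close>, so
  symmetry has to come from the derivative of the whole gradient, tested on directions with zero
  \<open>x\<close> component. Differentiability of \<open>Gx\<close> enters here.\<close>

lemma Hyy_sym: "a \<bullet> (Hyy z *v b) = b \<bullet> (Hyy z *v a)"
proof -
  obtain GxD where "(Gx has_derivative GxD) (at z)"
    using Gx_diff[of z] by (auto simp: differentiable_def)
  then have D: "((\<lambda>z. (Gx z, Gy z)) has_derivative (\<lambda>k. (GxD k, GyD z k))) (at z)"
    using Gy_has_derivative by (rule has_derivative_Pair)
  have "(g has_derivative (\<lambda>k. (Gx z, Gy z) \<bullet> k)) (at z)" for z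
    using g_grad[of z] by (simp add: inner_prod_def case_prod_beta')
  from symmetric_second_derivative_inner[OF this D, of "(0, a)" "(0, b)"] show ?thesis
    by (simp add: GyD_def)
qed

text \<open>In \<open>quadratic_form_bound\<close> this trades the factor \<mu> of the
  third-derivative term for \<open>Lg\<close>, so that it merges with the cross term.\<close>

lemma mu_le_Lg: "\<mu> \<le> Lg"
proof -
  define u :: "real^'p" where "u = axis undefined 1"
  have u: "norm u = 1" by (simp add: u_def)
  have "\<mu> * (norm u)\<^sup>2 \<le> u \<bullet> (Hyy undefined *v u)" by (rule Hyy_pd)
  also have "\<dots> \<le> norm u * norm (Hyy undefined *v u)" by (rule norm_cauchy_schwarz)
  also have "\<dots> \<le> norm u * (Lg * norm u)" by (intro mult_left_mono Hyy_bound) auto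
  finally show ?thesis by (simp add: u)
qed

definition S :: "((real^'n) \<times> (real^'p)) \<Rightarrow> real^'p \<Rightarrow> real^'p" where
  "S z u = matrix_inv (Hyy z) *v u"

lemma invertible_Hyy: "invertible (Hyy z)"
proof -
  have "u = 0" if "Hyy z *v u = 0" for u
    using Hyy_pd[of u z] that pos_consts by (simp add: mult_le_0_iff)
  then show ?thesis
    unfolding invertible_left_inverse matrix_left_invertible_ker by blast
qed

lemma Hyy_S [simp]: "Hyy z *v S z u = u" and S_Hyy [simp]: "S z (Hyy z *v u) = u"
  by (simp_all add: S_def invertible_matrix_inv_cancel[OF invertible_Hyy])

lemma S_linear: "linear (S z)"
  unfolding S_def[abs_def] by (rule matrix_vector_mul_linear)

lemmas S_add = linear_add[OF S_linear] and S_diff = linear_diff[OF S_linear]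
  and S_scaleR = linear_scale[OF S_linear] and S_0 [simp] = linear_0[OF S_linear]

lemma S_bound: "norm (S z u) \<le> norm u / \<mu>"
proof (cases "S z u = 0")
  case False
  have "\<mu> * (norm (S z u))\<^sup>2 \<le> S z u \<bullet> u"
    using Hyy_pd[of "S z u" z] by simp
  also have "\<dots> \<le> norm (S z u) * norm u" by (rule norm_cauchy_schwarz)
  finally have "\<mu> * norm (S z u) \<le> norm u"
    using False by (simp add: power2_eq_square)
  then show ?thesis using pos_consts by (simp add: field_simps)
qed (use pos_consts in simp)

lemma S_sym: "S z a \<bullet> b = a \<bullet> S z b"
  using Hyy_sym[of "S z a" z "S z b"] by (simp add: inner_commute)

lemma Hyy_diff_bound: "norm ((Hyy z - Hyy z') *v u) \<le> Qg * norm (z - z') * norm u"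
  using order_trans[OF norm_matrix_vector_mult_le_opnorm mult_right_mono[OF Hyy_lip]] by simp

lemma Hxy_diff_bound: "norm ((Hxy z - Hxy z') *v u) \<le> Qg * norm (z - z') * norm u"
  using order_trans[OF norm_matrix_vector_mult_le_opnorm mult_right_mono[OF Hxy_lip]] by simp

text \<open>The resolvent identity: a difference of inverses is the difference of the matrices
  placed between both inverses.\<close>

lemma S_diff_bound: "norm (S z u - S z' u) \<le> Qg * norm (z - z') * norm u / \<mu>\<^sup>2"
proof -
  have "S z u - S z' u = S z ((Hyy z' - Hyy z) *v S z' u)"
    by (simp add: matrix_vector_mult_diff_rdistrib S_diff)
  also have "norm \<dots> \<le> norm ((Hyy z' - Hyy z) *v S z' u) / \<mu>" by (rule S_bound)
  also have "\<dots> \<le> (Qg * norm (z' - z) * (norm u / \<mu>)) / \<mu>"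
    using pos_consts by (intro divide_right_mono order_trans[OF Hyy_diff_bound] mult_left_mono S_bound) auto
  finally show ?thesis by (simp add: power2_eq_square norm_minus_commute)
qed

lemma DH_bound: "norm (DH z k *v u) \<le> Qg * norm u * norm k"
proof (rule has_derivative_norm_bound)
  show "norm (Hyy z' *v u - Hyy z *v u) \<le> Qg * norm u * norm (z' - z)" for z'
    using Hyy_diff_bound[of z' z u] by (simp add: matrix_vector_mult_diff_rdistrib mult_ac)
  show "((\<lambda>z. Hyy z *v u) has_derivative (\<lambda>k. DH z k *v u)) (at z)"
    by (rule bounded_linear.has_derivative[OF _ Hyy_deriv])
      (auto intro!: linear_conv_bounded_linear[THEN iffD1] linearI
        simp: matrix_vector_mult_add_rdistrib scaleR_matrix_vector_assoc)
qed

section \<open>The Newton step, its derivative and the map \<open>Amap\<close>\<close>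

definition newton :: "((real^'n) \<times> (real^'p)) \<Rightarrow> real^'p" where
  "newton z = S z (Gy z)"

lemma newton_diff: "newton z' - newton z = S z' (Gy z' - Hyy z' *v newton z)"
  by (simp add: newton_def S_diff)

lemma residual_bound: "norm (Gy z' - Hyy z' *v newton z) \<le> (Lg + Qg * norm (newton z)) * norm (z' - z)"
proof -
  have "Gy z' - Hyy z' *v newton z = (Gy z' - Gy z) - (Hyy z' - Hyy z) *v newton z"
    by (simp add: matrix_vector_mult_diff_rdistrib newton_def)
  also have "norm \<dots> \<le> Lg * norm (z' - z) + Qg * norm (z' - z) * norm (newton z)"
    by (intro norm_triangle_le_diff add_mono Gy_lip Hyy_diff_bound)
  finally show ?thesis by (simp add: algebra_simps)
qed

text \<open>The constant grows with \<open>newton z\<close>, so this is a Lipschitz bound on bounded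
  sets only.\<close>

lemma newton_lip: "norm (newton z' - newton z) \<le> (Lg + Qg * norm (newton z)) / \<mu> * norm (z' - z)"
  unfolding newton_diff
  using order_trans[OF S_bound divide_right_mono[OF residual_bound]] pos_consts by simp

definition newtonD :: "((real^'n) \<times> (real^'p)) \<Rightarrow> ((real^'n) \<times> (real^'p)) \<Rightarrow> real^'p" where
  "newtonD z k = S z (GyD z k - DH z k *v newton z)"

text \<open>The residual \<open>R\<close>, with the Newton step frozen at \<open>z\<close>, vanishes
  at \<open>z\<close>. Replacing the moving inverse by the one at \<open>z\<close> therefore changes
  the product only to second order, and only the residual has to be differentiated.\<close>

lemma newton_has_derivative: "(newton has_derivative newtonD z) (at z)"
proof -
  define R where "R z' = Gy z' - Hyy z' *v newton z" for z'
  have "((\<lambda>z'. Hyy z' *v newton z) has_derivative (\<lambda>k. DH z k *v newton z)) (at z)"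
    by (rule bounded_linear.has_derivative[OF _ Hyy_deriv])
      (auto intro!: linear_conv_bounded_linear[THEN iffD1] linearI
        simp: matrix_vector_mult_add_rdistrib scaleR_matrix_vector_assoc)
  then have R': "(R has_derivative (\<lambda>k. GyD z k - DH z k *v newton z)) (at z)"
    unfolding R_def by (intro has_derivative_diff Gy_has_derivative)
  then have 1: "((\<lambda>z'. S z (R z')) has_derivative newtonD z) (at z)"
    unfolding newtonD_def[abs_def]
    using bounded_linear.has_derivative[OF linear_conv_bounded_linear[THEN iffD1, OF S_linear]] by blast
  define E where "E z' = S z' (R z') - S z (R z')" for z'
  have 2: "(E has_derivative (\<lambda>_. 0)) (at z)"
  proof (rule has_derivative_zero_if_quadratic)
    fix z'
    have "norm (E z') \<le> Qg * norm (z' - z) * norm (R z') / \<mu>\<^sup>2"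
      unfolding E_def by (rule S_diff_bound)
    also have "\<dots> \<le> Qg * norm (z' - z) * ((Lg + Qg * norm (newton z)) * norm (z' - z)) / \<mu>\<^sup>2"
      unfolding R_def using pos_consts by (intro divide_right_mono mult_left_mono residual_bound) auto
    finally show "norm (E z') \<le> (Qg * (Lg + Qg * norm (newton z)) / \<mu>\<^sup>2) * (norm (z' - z))\<^sup>2"
      by (simp add: power2_eq_square mult_ac)
  qed
  have "((\<lambda>z'. newton z + (S z (R z') + E z')) has_derivative (\<lambda>k. 0 + (newtonD z k + 0))) (at z)"
    by (intro has_derivative_add has_derivative_const 1 2)
  moreover have "newton z + (S z (R z') + E z') = newton z'" for z'
    using newton_diff[of z' z] by (simp add: E_def R_def algebra_simps)
  ultimately show ?thesis by simp
qed

lemma newton_continuous: "continuous_on UNIV newton"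
  by (meson continuous_at_imp_continuous_on has_derivative_continuous newton_has_derivative)

lemma Gy_continuous: "continuous_on UNIV Gy"
  by (meson continuous_at_imp_continuous_on has_derivative_continuous Gy_has_derivative)

definition Amap :: "((real^'n) \<times> (real^'p)) \<Rightarrow> (real^'n) \<times> (real^'p)" where
  "Amap z = (fst z, snd z - newton z)"

definition AmapD :: "((real^'n) \<times> (real^'p)) \<Rightarrow> ((real^'n) \<times> (real^'p)) \<Rightarrow> (real^'n) \<times> (real^'p)" where
  "AmapD z k = (fst k, snd k - newtonD z k)"

lemma Amap_has_derivative: "(Amap has_derivative AmapD z) (at z)"
  unfolding Amap_def[abs_def] AmapD_def[abs_def]
  by (intro has_derivative_Pair has_derivative_diff has_derivative_fst has_derivative_snd
      has_derivative_ident newton_has_derivative)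

lemma h_fun_eq: "h_fun f Gy Hyy \<beta> z = f (Amap z) + \<beta> / 2 * (norm (Gy z))\<^sup>2"
  by (simp add: h_fun_def A_map_def Amap_def newton_def S_def)

lemma h_continuous: "continuous_on UNIV (h_fun f Gy Hyy \<beta>)"
proof -
  have "continuous_on UNIV (\<lambda>z. f (Amap z))"
    unfolding Amap_def
    by (intro continuous_on_compose2[OF lipschitz_on_continuous_on[OF f_lip]] continuous_intros newton_continuous) auto
  then show ?thesis
    unfolding h_fun_eq[abs_def] by (intro continuous_intros Gy_continuous)
qed

section \<open>The set-valued field and the energy inequality\<close>

definition field :: "((real^'n) \<times> (real^'p)) \<Rightarrow> ((real^'n) \<times> (real^'p)) \<Rightarrow> (real^'n) \<times> (real^'p)" where
  "field z d = (fst d - Hxy z *v S z (snd d), \<beta>h *\<^sub>R Gy z)"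

definition G :: "((real^'n) \<times> (real^'p)) \<Rightarrow> ((real^'n) \<times> (real^'p)) set" where
  "G z = field z ` Df (Amap z)"

lemma beta_pos: "\<beta> > 0"
  using beta pos_consts by (intro less_le_trans[OF _ beta]) auto

lemma betah_mu: "\<beta>h * \<mu> \<ge> 8 * \<beta> * Lg\<^sup>2" and betah_pos: "\<beta>h > 0"
proof -
  have "\<beta> * (8 * Lg\<^sup>2 / \<mu>) \<le> \<beta> * Max {8 * Lg\<^sup>2 / \<mu>, 1 / (4 * \<mu>), \<mu> / 4}"
    using beta_pos by (intro mult_left_mono) auto
  then have le: "\<beta> * (8 * Lg\<^sup>2 / \<mu>) \<le> \<beta>h" using betah by linarith
  then show "\<beta>h * \<mu> \<ge> 8 * \<beta> * Lg\<^sup>2"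
    using pos_consts by (simp add: field_simps)
  show "\<beta>h > 0"
    by (rule less_le_trans[OF _ le]) (use beta_pos pos_consts in simp)
qed

lemma beta_mu: "Qg * Mf / \<mu>\<^sup>2 \<le> \<beta> * \<mu> / 4"
proof -
  have "4 * Qg * Mf / \<mu> ^ 3 * (\<mu> / 4) \<le> \<beta> * (\<mu> / 4)"
    using beta pos_consts by (intro mult_right_mono) auto
  then show ?thesis using pos_consts by (simp add: power2_eq_square power3_eq_cube field_simps)
qed

text \<open>The first entry leaves half of the squared \<open>x\<close> speed; the second matches a
  quarter of the penalty term \<beta> \<open>\<beta>h\<close> \<mu> \<open>q\<^sup>2\<close> with
  the squared \<open>y\<close> speed \<open>\<beta>h\<^sup>2 * q\<^sup>2\<close>.\<close>

definition rate :: real where "rate = min (1 / 2) (\<beta> * \<mu> / (4 * \<beta>h))"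

lemma rate_pos: "rate > 0"
  using beta_pos betah_pos pos_consts by (simp add: rate_def)

text \<open>\<open>U\<close> and \<open>q\<close> are the norms of the \<open>x\<close> component of
  the field and of \<open>Gy\<close>. The factor 4 in the bound on \<beta> makes the
  third-derivative term \<open>W\<close> cost at most a quarter of the cross term
  \<open>Y * U\<close> and a quarter of \<open>P\<close>. The factor 8 in the bound on
  \<open>\<beta>h\<close> makes \<open>P\<close> large enough to absorb the square of
  \<open>Y\<close> left by Young's inequality, with another quarter of \<open>P\<close> kept for the
  rate.\<close>

lemma quadratic_form_bound:
  assumes "U \<ge> 0" "q \<ge> 0"
  shows "U\<^sup>2 - Qg * Mf / \<mu>\<^sup>2 * q * (U + \<beta>h * q) - \<beta> * Lg * q * U + \<beta> * \<beta>h * \<mu> * q\<^sup>2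
    \<ge> rate * (U\<^sup>2 + \<beta>h\<^sup>2 * q\<^sup>2)"
proof -
  define Y where "Y = \<beta> * Lg * q"
  define P where "P = \<beta> * \<beta>h * \<mu> * q\<^sup>2"
  define W where "W = Qg * Mf / \<mu>\<^sup>2 * q * (U + \<beta>h * q)"
  have "W \<le> \<beta> * \<mu> / 4 * (q * (U + \<beta>h * q))"
    unfolding W_def mult.assoc[of _ q] using assms betah_pos by (intro mult_right_mono beta_mu) auto
  also have "\<dots> = \<beta> / 4 * q * U * \<mu> + P / 4"
    by (simp add: P_def power2_eq_square algebra_simps)
  also have "\<beta> / 4 * q * U * \<mu> \<le> \<beta> / 4 * q * U * Lg"
    using assms beta_pos mu_le_Lg by (intro mult_left_mono) auto
  finally have W: "W \<le> Y * U / 4 + P / 4"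
    by (simp add: Y_def mult_ac)
  have "\<beta> * q\<^sup>2 * (8 * \<beta> * Lg\<^sup>2) \<le> \<beta> * q\<^sup>2 * (\<beta>h * \<mu>)"
    using beta_pos betah_mu by (intro mult_left_mono) auto
  then have P: "8 * Y\<^sup>2 \<le> P"
    by (simp add: Y_def P_def power_mult_distrib power2_eq_square mult_ac)
  \<comment> \<open>The coefficient is 1 from the cross term plus 1/4 from \<open>W\<close>; Young's
    inequality in this form spends exactly half of \<open>U\<^sup>2\<close>.\<close>
  have "0 \<le> (U - 5 / 4 * Y)\<^sup>2" by simp
  then have "5 / 2 * (Y * U) \<le> U\<^sup>2 + 25 / 16 * Y\<^sup>2"
    by (simp add: power2_diff power_mult_distrib power_divide mult_ac)
  moreover have "0 \<le> Y\<^sup>2" by simp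
  moreover have "rate * U\<^sup>2 \<le> 1 / 2 * U\<^sup>2"
    by (intro mult_right_mono) (auto simp: rate_def)
  moreover have "rate * (\<beta>h\<^sup>2 * q\<^sup>2) \<le> P / 4"
  proof -
    have "rate * (\<beta>h\<^sup>2 * q\<^sup>2) \<le> \<beta> * \<mu> / (4 * \<beta>h) * (\<beta>h\<^sup>2 * q\<^sup>2)"
      by (intro mult_right_mono) (auto simp: rate_def)
    also have "\<dots> = P / 4"
      using betah_pos by (simp add: P_def power2_eq_square field_simps)
    finally show ?thesis .
  qed
  ultimately have "rate * U\<^sup>2 + rate * (\<beta>h\<^sup>2 * q\<^sup>2) \<le> U\<^sup>2 - W - Y * U + P"
    using W P by argo
  then show ?thesis
    by (simp add: W_def Y_def P_def distrib_left)
qed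

text \<open>Symmetry of the Hessian makes \<open>field z d\<close> pair with \<open>d\<close> to the full square of its first
  component; the remaining third-order and cross terms are absorbed by the choice of \<open>\<beta>\<close> and \<open>\<beta>h\<close>.\<close>
lemma field_ascent:
  assumes d: "norm d \<le> Mf"
  shows "AmapD z (field z d) \<bullet> d + \<beta> * (Gy z \<bullet> GyD z (field z d)) \<ge> rate * (norm (field z d))\<^sup>2"
proof -
  define u where "u = fst d - Hxy z *v S z (snd d)"
  define k where "k = field z d"
  have k: "fst k = u" "snd k = \<beta>h *\<^sub>R Gy z" by (auto simp: k_def field_def u_def)
  define E where "E = S z (DH z k *v newton z)"
  have GyD_k: "GyD z k = transpose (Hxy z) *v u + \<beta>h *\<^sub>R (Hyy z *v Gy z)"
    by (simp add: GyD_def k matrix_vector_mult_scaleR)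
  \<comment> \<open>The summand \<open>\<beta>h *\<^sub>R Gy z\<close> equals \<open>snd k\<close>
    and cancels in \<open>AmapD\<close>; \<open>E\<close> is what the variation of the Hessian
    contributes.\<close>
  have newtonD_k: "newtonD z k = S z (transpose (Hxy z) *v u) + \<beta>h *\<^sub>R Gy z - E"
    by (simp add: newtonD_def GyD_k E_def S_diff S_add S_scaleR)
  have nk: "(norm k)\<^sup>2 = (norm u)\<^sup>2 + \<beta>h\<^sup>2 * (norm (Gy z))\<^sup>2"
    using k by (simp add: norm_prod_def power_mult_distrib)
  have nk_le: "norm k \<le> norm u + \<beta>h * norm (Gy z)"
    using norm_Pair_le[of "fst k" "snd k"] betah_pos by (simp only: prod.collapse) (simp add: k)
  have "AmapD z k \<bullet> d = u \<bullet> fst d - S z (transpose (Hxy z) *v u) \<bullet> snd d + E \<bullet> snd d"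
    by (simp add: AmapD_def newtonD_k k inner_prod_def inner_diff_left inner_add_left)
  also have "S z (transpose (Hxy z) *v u) \<bullet> snd d = u \<bullet> (Hxy z *v S z (snd d))"
    by (simp add: S_sym inner_transpose_matrix_vector)
  also have "u \<bullet> fst d - u \<bullet> (Hxy z *v S z (snd d)) = (norm u)\<^sup>2"
    by (simp add: u_def inner_diff_right[symmetric] dot_square_norm)
  finally have eq1: "AmapD z k \<bullet> d = (norm u)\<^sup>2 + E \<bullet> snd d" .
  have nE: "norm E \<le> Qg / \<mu>\<^sup>2 * norm (Gy z) * norm k"
  proof -
    have "norm E \<le> norm (DH z k *v newton z) / \<mu>" unfolding E_def by (rule S_bound)
    also have "\<dots> \<le> Qg * (norm (Gy z) / \<mu>) * norm k / \<mu>"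
      unfolding newton_def using pos_consts
      by (intro divide_right_mono order_trans[OF DH_bound] mult_right_mono mult_left_mono S_bound) auto
    finally show ?thesis by (simp add: power2_eq_square)
  qed
  have "\<bar>E \<bullet> snd d\<bar> \<le> norm E * norm (snd d)" by (rule Cauchy_Schwarz_ineq2)
  also have "\<dots> \<le> (Qg / \<mu>\<^sup>2 * norm (Gy z) * norm k) * Mf"
    using nE d norm_snd_le[of "snd d" "fst d"] pos_consts by (intro mult_mono) auto
  also have "\<dots> \<le> (Qg / \<mu>\<^sup>2 * norm (Gy z) * (norm u + \<beta>h * norm (Gy z))) * Mf"
    using nk_le pos_consts by (intro mult_right_mono mult_left_mono) auto
  finally have E_d: "E \<bullet> snd d \<ge> - (Qg * Mf / \<mu>\<^sup>2 * norm (Gy z) * (norm u + \<beta>h * norm (Gy z)))"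
    by (simp add: mult_ac abs_le_iff)
  have "Gy z \<bullet> GyD z k = Gy z \<bullet> (transpose (Hxy z) *v u) + \<beta>h * (Gy z \<bullet> (Hyy z *v Gy z))"
    by (simp add: GyD_k inner_add_right)
  moreover have "\<beta>h * (Gy z \<bullet> (Hyy z *v Gy z)) \<ge> \<beta>h * (\<mu> * (norm (Gy z))\<^sup>2)"
    using betah_pos by (intro mult_left_mono Hyy_pd) auto
  moreover have "\<bar>Gy z \<bullet> (transpose (Hxy z) *v u)\<bar> \<le> norm (Gy z) * (Lg * norm u)"
    by (rule order_trans[OF Cauchy_Schwarz_ineq2]) (intro mult_left_mono transpose_Hxy_bound, auto)
  ultimately have "Gy z \<bullet> GyD z k \<ge> \<beta>h * (\<mu> * (norm (Gy z))\<^sup>2) - norm (Gy z) * (Lg * norm u)"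
    by linarith
  then have "\<beta> * (Gy z \<bullet> GyD z k) \<ge> \<beta> * (\<beta>h * (\<mu> * (norm (Gy z))\<^sup>2) - norm (Gy z) * (Lg * norm u))"
    using beta_pos by (intro mult_left_mono) auto
  then have "\<beta> * (Gy z \<bullet> GyD z k) \<ge> \<beta> * \<beta>h * \<mu> * (norm (Gy z))\<^sup>2 - \<beta> * Lg * norm (Gy z) * norm u"
    by (simp add: algebra_simps)
  then show ?thesis
    using eq1 E_d quadratic_form_bound[of "norm u" "norm (Gy z)"] unfolding k_def[symmetric] nk by simp
qed

section \<open>Closed graph and convex values of \<open>G\<close>, and its zeros\<close>

lemma Df_closed_graph:
  assumes "\<And>j. d j \<in> Df (u j)" "u \<longlonglongrightarrow> l" "d \<longlonglongrightarrow> m"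
  shows "m \<in> Df l"
proof -
  have cl: "closed {(z, d). d \<in> Df z}"
    using f_pot by (simp add: potential_of_def conservative_field_def)
  have "(\<lambda>j. (u j, d j)) \<longlonglongrightarrow> (l, m)"
    using assms(2,3) by (rule tendsto_Pair)
  then have "(l, m) \<in> {(z, d). d \<in> Df z}"
    by (rule closed_sequentially[OF cl, rotated]) (use assms(1) in auto)
  then show ?thesis by simp
qed

lemma S_tendsto:
  assumes u: "u \<longlonglongrightarrow> z" and a: "a \<longlonglongrightarrow> b"
  shows "(\<lambda>j. S (u j) (a j)) \<longlonglongrightarrow> S z b"
proof -
  have "(\<lambda>j. norm (a j - b) / \<mu> + Qg * norm (u j - z) * norm b / \<mu>\<^sup>2) \<longlonglongrightarrow> norm (b - b) / \<mu> + Qg * norm (z - z) * norm b / \<mu>\<^sup>2"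
    using pos_consts by (intro tendsto_intros u a) auto
  then have "(\<lambda>j. norm (a j - b) / \<mu> + Qg * norm (u j - z) * norm b / \<mu>\<^sup>2) \<longlonglongrightarrow> 0"
    by simp
  then have "(\<lambda>j. S (u j) (a j) - S z b) \<longlonglongrightarrow> 0"
  proof (rule Lim_null_comparison[rotated], intro always_eventually allI)
    fix j
    have "S (u j) (a j) - S z b = S (u j) (a j - b) + (S (u j) b - S z b)"
      by (simp add: S_diff)
    also have "norm \<dots> \<le> norm (a j - b) / \<mu> + Qg * norm (u j - z) * norm b / \<mu>\<^sup>2"
      by (intro norm_triangle_le add_mono S_bound S_diff_bound)
    finally show "norm (S (u j) (a j) - S z b) \<le> norm (a j - b) / \<mu> + Qg * norm (u j - z) * norm b / \<mu>\<^sup>2" .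
  qed
  then show ?thesis by (simp add: LIM_zero_iff)
qed

lemma Hxy_tendsto:
  assumes u: "u \<longlonglongrightarrow> z" and a: "a \<longlonglongrightarrow> b"
  shows "(\<lambda>j. Hxy (u j) *v a j) \<longlonglongrightarrow> Hxy z *v b"
proof -
  have "(\<lambda>j. Lg * norm (a j - b) + Qg * norm (u j - z) * norm b) \<longlonglongrightarrow> Lg * norm (b - b) + Qg * norm (z - z) * norm b"
    by (intro tendsto_intros u a)
  then have "(\<lambda>j. Lg * norm (a j - b) + Qg * norm (u j - z) * norm b) \<longlonglongrightarrow> 0"
    by simp
  then have "(\<lambda>j. Hxy (u j) *v a j - Hxy z *v b) \<longlonglongrightarrow> 0"
  proof (rule Lim_null_comparison[rotated], intro always_eventually allI)
    fix j
    have "Hxy (u j) *v a j - Hxy z *v b = Hxy (u j) *v (a j - b) + (Hxy (u j) - Hxy z) *v b"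
      by (simp add: matrix_vector_mult_diff_rdistrib matrix_vector_mult_diff_distrib)
    also have "norm \<dots> \<le> Lg * norm (a j - b) + Qg * norm (u j - z) * norm b"
      by (intro norm_triangle_le add_mono Hxy_bound Hxy_diff_bound)
    finally show "norm (Hxy (u j) *v a j - Hxy z *v b) \<le> Lg * norm (a j - b) + Qg * norm (u j - z) * norm b" .
  qed
  then show ?thesis by (simp add: LIM_zero_iff)
qed

lemma Gy_tendsto: "u \<longlonglongrightarrow> z \<Longrightarrow> (\<lambda>j. Gy (u j)) \<longlonglongrightarrow> Gy z"
  by (rule continuous_on_tendsto_compose[OF Gy_continuous]) auto

lemma newton_tendsto: "u \<longlonglongrightarrow> z \<Longrightarrow> (\<lambda>j. newton (u j)) \<longlonglongrightarrow> newton z"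
  by (rule continuous_on_tendsto_compose[OF newton_continuous]) auto

lemma field_tendsto:
  assumes "u \<longlonglongrightarrow> z" "d \<longlonglongrightarrow> m"
  shows "(\<lambda>j. field (u j) (d j)) \<longlonglongrightarrow> field z m"
  unfolding field_def
  by (intro tendsto_intros assms Hxy_tendsto S_tendsto Gy_tendsto)

text \<open>\<open>w\<close> is kept apart from \<open>newton\<close> so that the inexact directions
  of the algorithm, which merely converge to the Newton step, are covered. The selections
  \<open>d\<close> are bounded, and a convergent subsequence of them identifies the limit.\<close>

lemma G_graph_limit:
  assumes u: "u \<longlonglongrightarrow> z" and w: "w \<longlonglongrightarrow> newton z"
    and d: "\<And>j. d j \<in> Df (fst (u j), snd (u j) - w j)"
    and l: "(\<lambda>j. field (u j) (d j)) \<longlonglongrightarrow> l"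
  shows "l \<in> G z"
proof -
  obtain m r where r: "strict_mono r" and m: "(\<lambda>j. d (r j)) \<longlonglongrightarrow> m"
    by (rule bounded_convergent_subseq[of d Mf]) (use d Df_vals in blast)+
  have ur: "(\<lambda>j. u (r j)) \<longlonglongrightarrow> z" and wr: "(\<lambda>j. w (r j)) \<longlonglongrightarrow> newton z"
    and lr: "(\<lambda>j. field (u (r j)) (d (r j))) \<longlonglongrightarrow> l"
    using LIMSEQ_subseq_LIMSEQ[OF u r] LIMSEQ_subseq_LIMSEQ[OF w r] LIMSEQ_subseq_LIMSEQ[OF l r]
    by (simp_all add: o_def)
  have "(\<lambda>j. (fst (u (r j)), snd (u (r j)) - w (r j))) \<longlonglongrightarrow> Amap z"
    unfolding Amap_def by (intro tendsto_intros ur wr)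
  then have "m \<in> Df (Amap z)"
    by (rule Df_closed_graph[rotated, OF _ m]) (rule d)
  moreover have "l = field z m"
    using LIMSEQ_unique[OF lr field_tendsto[OF ur m]] .
  ultimately show ?thesis by (simp add: G_def)
qed

lemma G_graph_limit':
  assumes u: "u \<longlonglongrightarrow> z" and d: "\<And>j. d j \<in> G (u j)" and l: "d \<longlonglongrightarrow> l"
  shows "l \<in> G z"
proof -
  have "\<forall>j. \<exists>m. m \<in> Df (Amap (u j)) \<and> d j = field (u j) m"
    using d unfolding G_def by blast
  then obtain m where m: "\<And>j. m j \<in> Df (Amap (u j))" "\<And>j. d j = field (u j) (m j)"
    by metis
  show ?thesis
    using m(1) l by (intro G_graph_limit[OF u newton_tendsto[OF u], of m]) (auto simp: Amap_def m(2)[symmetric])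
qed

lemma G_closed: "closed (G z)"
  unfolding closed_sequential_limits by (auto intro: G_graph_limit'[OF tendsto_const])

lemma G_convex: "convex (G z)"
proof -
  \<comment> \<open>The second component of \<open>field z\<close> is constant, so the map is affine
    rather than linear; hence the condition on the weights.\<close>
  have "field z (a *\<^sub>R d + b *\<^sub>R d') = a *\<^sub>R field z d + b *\<^sub>R field z d'" if "a + b = 1" for a b d d'
    using that
    by (simp add: field_def S_add S_scaleR matrix_vector_right_distrib matrix_vector_mult_scaleR
        scaleR_diff_right scaleR_add_left[symmetric] scaleR_left_distrib[symmetric])
      (simp add: distrib_right[symmetric])
  then show ?thesis
    unfolding G_def convex_def
  proof (intro ballI allI impI, elim imageE)
    fix x y u v d d' assume uv: "0 \<le> (u::real)" "0 \<le> v" "u + v = 1"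
      and x: "x = field z d" "d \<in> Df (Amap z)" and y: "y = field z d'" "d' \<in> Df (Amap z)"
      and lin: "\<And>a b d d'. a + b = 1 \<Longrightarrow> field z (a *\<^sub>R d + b *\<^sub>R d') = a *\<^sub>R field z d + b *\<^sub>R field z d'"
    have "u *\<^sub>R d + v *\<^sub>R d' \<in> Df (Amap z)"
      using Df_vals x(2) y(2) uv by (intro convexD) auto
    then show "u *\<^sub>R x + v *\<^sub>R y \<in> field z ` Df (Amap z)"
      using lin[OF uv(3), of d d'] x(1) y(1) by (intro image_eqI) auto
  qed
qed

text \<open>A zero forces \<open>Gy z = 0\<close>, so the Newton map fixes \<open>z\<close> and the
  penalty vanishes. Critical values of \<open>h\<close> are thus stationary values of
  \<open>f\<close>, which carries the empty-interior hypothesis over to \<open>h\<close>.\<close>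

lemma zero_in_G_imp_stationary:
  assumes "0 \<in> G z"
  shows "stationary_BLO Df Gy Hxy Hyy z" "h_fun f Gy Hyy \<beta> z = f z"
proof -
  obtain d where d: "d \<in> Df (Amap z)" "fst d - Hxy z *v S z (snd d) = 0" "Gy z = 0"
    using assms betah_pos by (auto simp: G_def field_def prod_eq_iff)
  have A: "Amap z = z" by (simp add: Amap_def newton_def d(3))
  show "stationary_BLO Df Gy Hxy Hyy z"
    unfolding stationary_BLO_def using d A by (metis S_def prod.collapse)
  show "h_fun f Gy Hyy \<beta> z = f z" by (simp add: h_fun_eq A d(3))
qed

section \<open>Decrease of \<open>h\<close> along solutions of the inclusion\<close>

lemma AmapD_scaleR: "AmapD z (c *\<^sub>R k) = c *\<^sub>R AmapD z k"
  using linear_scale[OF has_derivative_linear[OF Amap_has_derivative]] .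

lemma GyD_scaleR: "GyD z (c *\<^sub>R k) = c *\<^sub>R GyD z k"
  using linear_scale[OF has_derivative_linear[OF Gy_has_derivative]] .

text \<open>\<open>\<xi>\<close> is meant to be a trajectory piece of duration \<open>s\<close>,
  reversed and rescaled to the unit interval on which the potential identity is stated; this
  explains the factor \<open>1 / s\<close> and the sign in the inclusion.
  \<open>field_ascent\<close> applies to the selected element, and the maximum over the field can
  only be larger.\<close>

lemma ascent_along_curve:
  assumes lip: "K-lipschitz_on UNIV \<xi>" and bound: "\<And>t. norm (\<xi> t) \<le> R" and s: "s > 0" and \<delta>: "\<delta> \<ge> 0"
    and incl: "\<And>t e. 0 < t \<Longrightarrow> t < 1 \<Longrightarrow> (\<xi> has_vector_derivative e) (at t) \<Longrightarrow> (1 / s) *\<^sub>R e \<in> G (\<xi> t)"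
    and low: "\<And>t d. 0 < t \<Longrightarrow> t < 1 \<Longrightarrow> d \<in> G (\<xi> t) \<Longrightarrow> norm d \<ge> \<delta>"
  shows "h_fun f Gy Hyy \<beta> (\<xi> 0) + s * rate * \<delta>\<^sup>2 \<le> h_fun f Gy Hyy \<beta> (\<xi> 1)"
proof -
  have K: "K \<ge> 0" using lip by (rule lipschitz_on_nonneg)
  have \<xi>_lip: "norm (\<xi> t - \<xi> t') \<le> K * \<bar>t - t'\<bar>" for t t'
    using lipschitz_onD[OF lip, of t t'] by (simp add: dist_norm)
  \<comment> \<open>A bound on \<open>Gy\<close>, hence on \<open>newton\<close>, along the curve
    makes the local Lipschitz estimates for \<open>Amap\<close> and the penalty uniform.\<close>
  define B1 where "B1 = norm (Gy 0) + Lg * R"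
  have B1: "norm (Gy (\<xi> t)) \<le> B1" for t
  proof -
    have "norm (Gy (\<xi> t)) \<le> norm (Gy 0) + norm (Gy (\<xi> t) - Gy 0)"
      by (metis add.commute diff_add_cancel norm_triangle_ineq)
    also have "\<dots> \<le> norm (Gy 0) + Lg * R"
      using Gy_lip[of "\<xi> t" 0] mult_left_mono[OF bound[of t] less_imp_le[OF pos_consts(3)]] by simp
    finally show ?thesis by (simp add: B1_def)
  qed
  have B1_nonneg: "B1 \<ge> 0" using B1[of 0] norm_ge_zero order_trans by blast
  define L2 where "L2 = 1 + (Lg + Qg * (B1 / \<mu>)) / \<mu>"
  have L2: "L2 \<ge> 0" using B1_nonneg pos_consts by (simp add: L2_def)
  define \<gamma> where "\<gamma> t = Amap (\<xi> t)" for t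
  have \<gamma>_lip: "(L2 * K)-lipschitz_on UNIV \<gamma>"
  proof (rule lipschitz_onI)
    fix t t' :: real
    have "\<gamma> t - \<gamma> t' = (\<xi> t - \<xi> t') - (0, newton (\<xi> t) - newton (\<xi> t'))"
      by (simp add: \<gamma>_def Amap_def prod_eq_iff)
    also have "norm \<dots> \<le> norm (\<xi> t - \<xi> t') + norm (newton (\<xi> t) - newton (\<xi> t'))"
      using norm_triangle_ineq4[of "\<xi> t - \<xi> t'" "(0, newton (\<xi> t) - newton (\<xi> t'))"] by (simp add: norm_Pair)
    also have "\<dots> \<le> norm (\<xi> t - \<xi> t') + (Lg + Qg * (B1 / \<mu>)) / \<mu> * norm (\<xi> t - \<xi> t')"
    proof -
      have "norm (newton (\<xi> t')) \<le> B1 / \<mu>"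
        unfolding newton_def using pos_consts
        by (intro order_trans[OF S_bound] divide_right_mono B1) auto
      then show ?thesis
        using pos_consts
        by (intro add_left_mono order_trans[OF newton_lip] mult_right_mono divide_right_mono add_left_mono mult_left_mono) auto
    qed
    also have "\<dots> = L2 * norm (\<xi> t - \<xi> t')" by (simp add: L2_def algebra_simps)
    also have "\<dots> \<le> L2 * (K * \<bar>t - t'\<bar>)" by (intro mult_left_mono \<xi>_lip L2)
    finally show "dist (\<gamma> t) (\<gamma> t') \<le> L2 * K * dist t t'" by (simp add: dist_norm mult_ac)
  qed (use K L2 in simp)
  define Q where "Q t = \<beta> / 2 * (norm (Gy (\<xi> t)))\<^sup>2" for t
  have Q_lip: "(\<beta> * B1 * (Lg * K))-lipschitz_on UNIV Q"
  proof (rule lipschitz_onI)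
    fix t t' :: real
    let ?a = "norm (Gy (\<xi> t))" and ?b = "norm (Gy (\<xi> t'))"
    have 1: "\<bar>?a - ?b\<bar> \<le> Lg * (K * \<bar>t - t'\<bar>)"
      using pos_consts
      by (intro order_trans[OF norm_triangle_ineq3] order_trans[OF Gy_lip] mult_left_mono \<xi>_lip) auto
    have "Q t - Q t' = \<beta> / 2 * ((?a + ?b) * (?a - ?b))"
      by (simp add: Q_def power2_eq_square algebra_simps)
    then have "dist (Q t) (Q t') = \<bar>\<beta> / 2 * ((?a + ?b) * (?a - ?b))\<bar>"
      by (simp only: dist_real_def)
    also have "\<dots> = \<beta> / 2 * ((?a + ?b) * \<bar>?a - ?b\<bar>)"
      using beta_pos by (simp add: abs_mult)
    also have "\<dots> \<le> \<beta> / 2 * ((2 * B1) * (Lg * (K * \<bar>t - t'\<bar>)))"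
      using beta_pos B1[of t] B1[of t'] B1_nonneg by (intro mult_left_mono mult_mono 1) auto
    finally show "dist (Q t) (Q t') \<le> \<beta> * B1 * (Lg * K) * dist t t'"
      by (simp add: dist_real_def mult_ac)
  qed (use beta_pos B1_nonneg K pos_consts in simp)
  obtain \<xi>' where \<xi>': "AE t in lborel. (\<xi> has_vector_derivative \<xi>' t) (at t)"
    using lipschitz_on_vector_derivative_AE[OF lip] by blast
  obtain \<phi> where \<phi>_int: "\<And>a b. a \<le> b \<Longrightarrow> (\<phi> has_integral (Q b - Q a)) {a..b}"
    and \<phi>: "AE t in lborel. (Q has_vector_derivative \<phi> t) (at t)"
    using lipschitz_on_real_derivative_AE[OF Q_lip] by blast
  define \<gamma>' where "\<gamma>' t = AmapD (\<xi> t) (\<xi>' t)" for t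
  have d\<gamma>: "(\<gamma> has_vector_derivative \<gamma>' t) (at t)" if "(\<xi> has_vector_derivative \<xi>' t) (at t)" for t
    unfolding \<gamma>_def \<gamma>'_def has_vector_derivative_def
    using has_derivative_compose[OF that[unfolded has_vector_derivative_def] Amap_has_derivative]
    by (simp add: AmapD_scaleR)
  have dQ: "(Q has_vector_derivative \<beta> * (Gy (\<xi> t) \<bullet> GyD (\<xi> t) (\<xi>' t))) (at t)"
    if "(\<xi> has_vector_derivative \<xi>' t) (at t)" for t
  proof -
    have D: "((\<lambda>t. Gy (\<xi> t)) has_derivative (\<lambda>h. h *\<^sub>R GyD (\<xi> t) (\<xi>' t))) (at t)"
      using has_derivative_compose[OF that[unfolded has_vector_derivative_def] Gy_has_derivative]
      by (simp add: GyD_scaleR)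
    have "((\<lambda>t. \<beta> / 2 * (Gy (\<xi> t) \<bullet> Gy (\<xi> t))) has_derivative (\<lambda>h. h *\<^sub>R (\<beta> * (Gy (\<xi> t) \<bullet> GyD (\<xi> t) (\<xi>' t))))) (at t)"
      by (rule has_derivative_eq_rhs[OF has_derivative_mult_right[OF has_derivative_inner[OF D D]]])
        (auto simp: inner_commute algebra_simps)
    then show ?thesis
      by (simp add: Q_def[abs_def] has_vector_derivative_def power2_norm_eq_inner)
  qed
  have "(field_integrand Df \<gamma> \<gamma>' has_integral (f (\<gamma> 1) - f (\<gamma> 0))) {0..1}"
  proof -
    have "ae_deriv_curve \<gamma> \<gamma>'"
      unfolding ae_deriv_curve_def using \<xi>' by (rule AE_mp) (auto intro!: AE_I2 d\<gamma>)
    then show ?thesis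
      using f_pot lipschitz_imp_abs_cont_curve[OF \<gamma>_lip] by (simp add: potential_of_def)
  qed
  then have int: "((\<lambda>t. field_integrand Df \<gamma> \<gamma>' t + \<phi> t) has_integral (f (\<gamma> 1) - f (\<gamma> 0) + (Q 1 - Q 0))) {0..1}"
    by (intro has_integral_add \<phi>_int) auto
  have ge: "s * rate * \<delta>\<^sup>2 \<le> field_integrand Df \<gamma> \<gamma>' t + \<phi> t"
    if t: "0 < t" "t < 1" and der: "(\<xi> has_vector_derivative \<xi>' t) (at t)"
      and derQ: "(Q has_vector_derivative \<phi> t) (at t)" for t
  proof -
    have inG: "(1 / s) *\<^sub>R \<xi>' t \<in> G (\<xi> t)" by (rule incl[OF t der])
    then obtain d where d: "d \<in> Df (\<gamma> t)" and eq: "(1 / s) *\<^sub>R \<xi>' t = field (\<xi> t) d"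
      by (auto simp: G_def \<gamma>_def)
    have \<xi>'_eq: "\<xi>' t = s *\<^sub>R field (\<xi> t) d"
      using s by (simp add: eq[symmetric])
    \<comment> \<open>The integrand is a \<open>Sup\<close>, which dominates the chosen element only
      because the values of the field are bounded.\<close>
    have "bdd_above ((\<lambda>v. \<gamma>' t \<bullet> v) ` Df (\<gamma> t))"
    proof (rule bdd_aboveI2)
      fix v assume "v \<in> Df (\<gamma> t)"
      then have "norm v \<le> Mf" using Df_vals by blast
      then show "\<gamma>' t \<bullet> v \<le> norm (\<gamma>' t) * Mf"
        by (intro order_trans[OF norm_cauchy_schwarz] mult_left_mono) auto
    qed
    then have "\<gamma>' t \<bullet> d \<le> field_integrand Df \<gamma> \<gamma>' t"
      unfolding field_integrand_def using d by (intro cSup_upper) auto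
    \<comment> \<open>\<open>\<phi>\<close> came from a density; uniqueness of derivatives
      identifies it with the chain-rule expression.\<close>
    moreover have "\<phi> t = \<beta> * (Gy (\<xi> t) \<bullet> GyD (\<xi> t) (\<xi>' t))"
      using vector_derivative_unique_at[OF derQ dQ[OF der]] .
    moreover have "s * (rate * (norm (field (\<xi> t) d))\<^sup>2)
        \<le> s * (AmapD (\<xi> t) (field (\<xi> t) d) \<bullet> d + \<beta> * (Gy (\<xi> t) \<bullet> GyD (\<xi> t) (field (\<xi> t) d)))"
      using s d Df_vals by (intro mult_left_mono field_ascent) auto
    moreover have "s * (rate * \<delta>\<^sup>2) \<le> s * (rate * (norm (field (\<xi> t) d))\<^sup>2)"
      using s rate_pos \<delta> low[OF t inG] unfolding eq by (intro mult_left_mono power_mono) auto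
    ultimately show ?thesis
      by (simp add: \<gamma>'_def \<xi>'_eq AmapD_scaleR GyD_scaleR algebra_simps)
  qed
  have "AE t in lborel. 0 < t \<and> t < 1 \<longrightarrow> s * rate * \<delta>\<^sup>2 \<le> field_integrand Df \<gamma> \<gamma>' t + \<phi> t"
    using \<xi>' \<phi> by eventually_elim (auto intro: ge)
  then have "s * rate * \<delta>\<^sup>2 * (1 - 0) \<le> f (\<gamma> 1) - f (\<gamma> 0) + (Q 1 - Q 0)"
    by (intro has_integral_ge_const_AE[OF int]) auto
  then show ?thesis by (simp add: h_fun_eq \<gamma>_def Q_def)
qed

text \<open>Otherwise elements tending to 0 at points tending to \<open>z\<close> would, by the
  closed graph, put 0 into \<open>G z\<close>.\<close>

lemma G_bounded_away:
  assumes "0 \<notin> G z"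
  obtains \<rho> \<delta> where "\<rho> > 0" "\<delta> > 0" "\<And>z' d. norm (z' - z) < \<rho> \<Longrightarrow> d \<in> G z' \<Longrightarrow> norm d \<ge> \<delta>"
proof (rule ccontr)
  note away = that
  assume "\<not> thesis"
  then have "\<exists>z' d. norm (z' - z) < e \<and> d \<in> G z' \<and> norm d < e" if "e > 0" for e
    using away[OF that that] by (meson not_le)
  then have "\<forall>n::nat. \<exists>z' d. norm (z' - z) < inverse (real (Suc n)) \<and> d \<in> G z' \<and> norm d < inverse (real (Suc n))"
    by (metis inverse_positive_iff_positive of_nat_0_less_iff zero_less_Suc)
  then obtain u d where ud: "\<And>n::nat. norm (u n - z) < inverse (real (Suc n))" "\<And>n. d n \<in> G (u n)"
    "\<And>n. norm (d n) < inverse (real (Suc n))"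
    by metis
  have "(\<lambda>n. u n - z) \<longlonglongrightarrow> 0"
    by (rule LIMSEQ_norm_0) (use ud(1) in \<open>auto simp: inverse_eq_divide less_imp_le\<close>)
  then have u: "u \<longlonglongrightarrow> z" by (simp add: LIM_zero_iff)
  have "d \<longlonglongrightarrow> 0"
    by (rule LIMSEQ_norm_0) (use ud(3) in \<open>auto simp: inverse_eq_divide less_imp_le\<close>)
  with G_graph_limit'[OF u ud(2)] assms show False by blast
qed

lemma descent_along_curve:
  assumes z: "0 \<notin> G z" and lip: "C-lipschitz_on UNIV \<zeta>" and \<zeta>0: "\<zeta> 0 = z"
    and incl: "\<And>t e. 0 < t \<Longrightarrow> t < 1 \<Longrightarrow> (\<zeta> has_vector_derivative e) (at t) \<Longrightarrow> - e \<in> G (\<zeta> t)"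
  shows "\<exists>\<sigma>. 0 < \<sigma> \<and> \<sigma> \<le> 1 \<and> h_fun f Gy Hyy \<beta> (\<zeta> \<sigma>) < h_fun f Gy Hyy \<beta> z \<and>
    (\<forall>s\<in>{0..\<sigma>}. h_fun f Gy Hyy \<beta> (\<zeta> s) \<le> h_fun f Gy Hyy \<beta> z)"
proof -
  have C: "C \<ge> 0" using lip by (rule lipschitz_on_nonneg)
  have \<zeta>_lip: "norm (\<zeta> t - \<zeta> t') \<le> C * \<bar>t - t'\<bar>" for t t'
    using lipschitz_onD[OF lip, of t t'] by (simp add: dist_norm)
  obtain \<rho> \<delta> where \<rho>: "\<rho> > 0" and \<delta>: "\<delta> > 0"
    and away: "\<And>z' d. norm (z' - z) < \<rho> \<Longrightarrow> d \<in> G z' \<Longrightarrow> norm d \<ge> \<delta>"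
    using G_bounded_away[OF z] by blast
  \<comment> \<open>At speed at most \<open>C\<close> the curve needs at least this long to leave
    the ball of radius \<open>\<rho>\<close>; the added 1 covers \<open>C = 0\<close>.\<close>
  define \<sigma> where "\<sigma> = min 1 (\<rho> / (C + 1))"
  have \<sigma>: "0 < \<sigma>" "\<sigma> \<le> 1" using \<rho> C by (auto simp: \<sigma>_def)
  have near: "norm (\<zeta> t - z) < \<rho>" if t: "0 \<le> t" "t < \<sigma>" for t
  proof -
    have "norm (\<zeta> t - z) \<le> C * t" using \<zeta>_lip[of t 0] t by (simp add: \<zeta>0)
    also have "\<dots> \<le> (C + 1) * t" using t by (simp add: algebra_simps)
    also have "\<dots> < \<rho>" using t C by (simp add: \<sigma>_def pos_less_divide_eq mult.commute)
    finally show ?thesis .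
  qed
  \<comment> \<open>Reversing each initial piece separately gives the strict drop at
    \<open>\<sigma>\<close> and the bound at every earlier time at once.\<close>
  have dec: "h_fun f Gy Hyy \<beta> (\<zeta> s) + s * rate * \<delta>\<^sup>2 \<le> h_fun f Gy Hyy \<beta> z" if s: "0 < s" "s \<le> \<sigma>" for s
  proof -
    \<comment> \<open>The reversed clock runs from \<open>s\<close> to 0 and is clamped, so that
      \<open>\<xi>\<close> is Lipschitz on the whole line.\<close>
    define \<tau> where "\<tau> t = s * (1 - max 0 (min t 1))" for t :: real
    have \<tau>: "0 \<le> \<tau> t" "\<tau> t \<le> s" for t
      using s by (auto simp: \<tau>_def mult_le_cancel_left1 intro: mult_left_le)
    define \<xi> where "\<xi> t = \<zeta> (\<tau> t)" for t
    have "h_fun f Gy Hyy \<beta> (\<xi> 0) + s * rate * \<delta>\<^sup>2 \<le> h_fun f Gy Hyy \<beta> (\<xi> 1)"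
    proof (rule ascent_along_curve)
      show "(C * s)-lipschitz_on UNIV \<xi>"
      proof (rule lipschitz_onI)
        fix t t' :: real
        have "dist (\<xi> t) (\<xi> t') \<le> C * \<bar>\<tau> t - \<tau> t'\<bar>"
          unfolding \<xi>_def dist_norm by (rule \<zeta>_lip)
        also have "\<bar>\<tau> t - \<tau> t'\<bar> = s * \<bar>max 0 (min t 1) - max 0 (min t' 1)\<bar>"
          using s by (simp add: \<tau>_def right_diff_distrib[symmetric] abs_mult abs_minus_commute)
        also have "C * \<dots> \<le> C * (s * dist t t')"
          using s C by (intro mult_left_mono) (auto simp: dist_real_def)
        finally show "dist (\<xi> t) (\<xi> t') \<le> C * s * dist t t'" by (simp add: mult_ac)
      qed (use C s in simp)
      show "norm (\<xi> t) \<le> norm z + C" for t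
      proof -
        have "norm (\<zeta> (\<tau> t) - \<zeta> 0) \<le> C * \<bar>\<tau> t - 0\<bar>" by (rule \<zeta>_lip)
        also have "\<dots> \<le> C" using C \<tau>[of t] s \<sigma> by (auto intro: mult_left_le)
        finally show ?thesis
          using norm_triangle_sub[of "\<zeta> (\<tau> t)" "\<zeta> 0"] by (simp add: \<xi>_def \<zeta>0)
      qed
      show "(1 / s) *\<^sub>R e \<in> G (\<xi> t)" if t: "0 < t" "t < 1" and der: "(\<xi> has_vector_derivative e) (at t)" for t e
      proof -
        have \<tau>t: "\<tau> t = s * (1 - t)" using t by (simp add: \<tau>_def)
        have st: "0 < s * (1 - t)" "s * (1 - t) < s" using s t by auto
        \<comment> \<open>Undoing the clock turns a derivative \<open>e\<close> of
          \<open>\<xi>\<close> into the derivative \<open>(- 1 / s) *\<^sub>R e\<close> of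
          \<open>\<zeta>\<close>, to which the inclusion applies.\<close>
        have inv: "((\<lambda>r. 1 - r / s) has_vector_derivative - 1 / s) (at (s * (1 - t)))"
          using s by (auto intro!: derivative_eq_intros simp: has_real_derivative_iff_has_vector_derivative[symmetric])
        have D: "((\<lambda>r. \<xi> (1 - r / s)) has_vector_derivative (- 1 / s) *\<^sub>R e) (at (s * (1 - t)))"
          using vector_diff_chain_at[OF inv, of \<xi> e] der s by (simp add: o_def)
        have eq: "\<xi> (1 - r / s) = \<zeta> r" if "r \<in> {0<..<s}" for r
        proof -
          have "0 \<le> 1 - r / s" "1 - r / s \<le> 1" using that s by auto
          then have "\<tau> (1 - r / s) = r" using s unfolding \<tau>_def by simp
          then show ?thesis by (simp add: \<xi>_def)
        qed
        have "(\<zeta> has_vector_derivative (- 1 / s) *\<^sub>R e) (at (s * (1 - t)))"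
          by (rule has_vector_derivative_transform_within_open[OF D open_greaterThanLessThan _ eq]) (use st in simp_all)
        from incl[OF _ _ this] show ?thesis
          using st s \<sigma> by (simp add: \<xi>_def \<tau>t)
      qed
      show "\<delta> \<le> norm d" if t: "0 < t" "t < 1" and d: "d \<in> G (\<xi> t)" for t d
      proof (rule away[OF near])
        have "\<tau> t = s * (1 - t)" using t by (simp add: \<tau>_def)
        also have "\<dots> < s" using s t by simp
        finally show "\<tau> t < \<sigma>" using s by simp
        show "0 \<le> \<tau> t" by (rule \<tau>)
        show "d \<in> G (\<zeta> (\<tau> t))" using d by (simp add: \<xi>_def)
      qed
    qed (use s \<delta> in auto)
    then show ?thesis by (simp add: \<xi>_def \<tau>_def \<zeta>0)
  qed
  have pos: "s * rate * \<delta>\<^sup>2 > 0" if "s > 0" for s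
    using that rate_pos \<delta> by simp
  have "h_fun f Gy Hyy \<beta> (\<zeta> s) \<le> h_fun f Gy Hyy \<beta> z" if "s \<in> {0..\<sigma>}" for s
    using that dec[of s] pos[of s] by (cases "s = 0") (auto simp: \<zeta>0)
  moreover have "h_fun f Gy Hyy \<beta> (\<zeta> \<sigma>) < h_fun f Gy Hyy \<beta> z"
    using dec[of \<sigma>] pos[of \<sigma>] \<sigma> by simp
  ultimately show ?thesis using \<sigma> by blast
qed

end

section \<open>Convergence of the algorithm\<close>

text \<open>Carries convergence from the shifted iterates back to the original ones; boundedness
  supplies the uniform continuity of \<open>h\<close>.\<close>

lemma convergent_if_asymptotic:
  fixes h :: "'a::euclidean_space \<Rightarrow> real"
  assumes cont: "continuous_on UNIV h" and conv: "convergent (\<lambda>k. h (u k))"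
    and diff: "(\<lambda>k. u k - v k) \<longlonglongrightarrow> 0" and bu: "\<And>k. norm (u k) \<le> B" and bv: "\<And>k. norm (v k) \<le> B"
  shows "convergent (\<lambda>k. h (v k))"
proof -
  have "uniformly_continuous_on (cball 0 B) h"
    by (intro compact_uniformly_continuous continuous_on_subset[OF cont]) auto
  moreover have "(\<lambda>k. dist (u k) (v k)) \<longlonglongrightarrow> 0"
    using tendsto_norm_zero[OF diff] by (simp add: dist_norm)
  ultimately have "(\<lambda>k. dist (h (u k)) (h (v k))) \<longlonglongrightarrow> 0"
    using bu bv unfolding uniformly_continuous_on_sequentially by simp
  then have *: "(\<lambda>k. h (u k) - h (v k)) \<longlonglongrightarrow> 0"
    unfolding dist_norm by (rule tendsto_norm_zero_cancel)
  obtain H where "(\<lambda>k. h (u k)) \<longlonglongrightarrow> H" using conv by (auto simp: convergent_def)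
  from tendsto_diff[OF this *] show ?thesis by (auto simp: convergent_def)
qed

theorem theorem4p3:
  fixes f g :: "((real^'n) \<times> (real^'p)) \<Rightarrow> real"
    and Gx :: "((real^'n) \<times> (real^'p)) \<Rightarrow> real^'n"
    and Gy :: "((real^'n) \<times> (real^'p)) \<Rightarrow> real^'p"
    and Hyy :: "((real^'n) \<times> (real^'p)) \<Rightarrow> real^'p^'p"
    and Hxy :: "((real^'n) \<times> (real^'p)) \<Rightarrow> real^'p^'n"
    and Df :: "((real^'n) \<times> (real^'p)) \<Rightarrow> (((real^'n) \<times> (real^'p))) set"
    and Mf \<mu> Lg Qg \<beta> \<beta>h :: real
    and x dx :: "nat \<Rightarrow> real^'n"
    and y w dy v :: "nat \<Rightarrow> real^'p"
    and \<eta> \<epsilon>1 \<epsilon>2 :: "nat \<Rightarrow> real"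
  assumes pos_consts: "Mf > 0" "\<mu> > 0" "Lg > 0" "Qg > 0"
    \<comment> \<open>(A1)\<close>
    and f_lip: "Mf-lipschitz_on UNIV f"
    and g_grad: "\<And>z. (g has_derivative (\<lambda>(a, b). Gx z \<bullet> a + Gy z \<bullet> b)) (at z)"
    and Gx_diff: "\<And>z. Gx differentiable (at z)"
    and Gy_deriv: "\<And>z. (Gy has_derivative (\<lambda>(a, b). transpose (Hxy z) *v a + Hyy z *v b)) (at z)"
    and Hyy_pd: "\<And>z u. u \<bullet> (Hyy z *v u) \<ge> \<mu> * (norm u)\<^sup>2"
    and grad_lip: "Lg-lipschitz_on UNIV (\<lambda>z. (Gx z, Gy z))"
    and Hyy_lip: "\<And>z z'. opnorm (Hyy z - Hyy z') \<le> Qg * norm (z - z')"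
    and Hxy_lip: "\<And>z z'. opnorm (Hxy z - Hxy z') \<le> Qg * norm (z - z')"
    and Hyy_C1: "\<exists>DH :: ((real^'n) \<times> (real^'p)) \<Rightarrow> (((real^'n) \<times> (real^'p)) \<Rightarrow>\<^sub>L (real^'p^'p)).
                   (\<forall>z. (Hyy has_derivative blinfun_apply (DH z)) (at z)) \<and> continuous_on UNIV DH"
    \<comment> \<open>(A2)\<close>
    and f_pot: "potential_of f Df"
    and Df_vals: "\<And>z. convex (Df z) \<and> compact (Df z) \<and> (\<forall>d \<in> Df z. norm d \<le> Mf)"
    \<comment> \<open>parameters\<close>
    and beta: "\<beta> \<ge> 4 * Qg * Mf / \<mu> ^ 3"
    and betah: "\<beta>h \<ge> \<beta> * Max {8 * Lg\<^sup>2 / \<mu>, 1 / (4 * \<mu>), \<mu> / 4}"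
    \<comment> \<open>Algorithm 2\<close>
    and alg_w: "\<And>k. norm (Hyy (x k, y k) *v w k - Gy (x k, y k)) \<le> \<epsilon>1 k"
    and alg_d: "\<And>k. (dx k, dy k) \<in> Df (x k, y k - w k)"
    and alg_v: "\<And>k. norm (Hyy (x k, y k) *v v k - dy k) \<le> \<epsilon>2 k"
    and alg_x: "\<And>k. x (Suc k) = x k - \<eta> k *\<^sub>R (dx k - Hxy (x k, y k) *v v k)"
    and alg_y: "\<And>k. y (Suc k) = y k - (\<eta> k * \<beta>h) *\<^sub>R Gy (x k, y k)"
    \<comment> \<open>(a)\<close>
    and bdd: "\<exists>B. \<forall>k. norm (x k) + norm (y k) \<le> B"
    \<comment> \<open>(b)\<close>
    and eta_nonneg: "\<And>k. \<eta> k \<ge> 0"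
    and eta_sum: "\<not> summable \<eta>"
    and eta_sq: "summable (\<lambda>k. (\<eta> k)\<^sup>2)"
    \<comment> \<open>(c)\<close>
    and crit_vals: "interior {f z | z. stationary_BLO Df Gy Hxy Hyy z} = {}"
    and eps1_lim: "\<epsilon>1 \<longlonglongrightarrow> 0"
    and eps2_sum: "summable (\<lambda>k. \<epsilon>2 k * \<eta> k)"
  shows "(\<forall>z r. strict_mono r \<and> (\<lambda>k. (x (r k), y (r k))) \<longlonglongrightarrow> z \<longrightarrow>
            stationary_BLO Df Gy Hxy Hyy z)
         \<and> convergent (\<lambda>k. h_fun f Gy Hyy \<beta> (x k, y k))"
proof -
  obtain DH :: "((real^'n) \<times> (real^'p)) \<Rightarrow> (((real^'n) \<times> (real^'p)) \<Rightarrow>\<^sub>L (real^'p^'p))"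
    where DH: "\<And>z. (Hyy has_derivative blinfun_apply (DH z)) (at z)"
    using Hyy_C1 by blast
  interpret bilevel f g Gx Gy Hyy Hxy "\<lambda>z. blinfun_apply (DH z)" Df Mf \<mu> Lg Qg \<beta> \<beta>h
    by unfold_locales (fact assms(1-12) f_pot Df_vals beta betah DH)+
  define z where "z k = (x k, y k)" for k
  define d where "d k = (dx k, dy k)" for k
  define e where "e k = Hyy (z k) *v v k - dy k" for k
  \<comment> \<open>The residual \<open>e\<close> of the second solve, carried through the inverse
    Hessian and \<open>Hxy\<close> and weighted by the step size; its norm is at most
    \<open>Lg / \<mu> * (\<epsilon>2 k * \<eta> k)\<close>.\<close>
  define err where "err k = (\<eta> k *\<^sub>R (Hxy (z k) *v S (z k) (e k)), 0 :: real^'p)" for k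
  have step: "z (Suc k) = z k - \<eta> k *\<^sub>R field (z k) (d k) + err k" for k
  proof -
    have "v k = S (z k) (dy k + e k)"
      by (simp add: e_def)
    then have "Hxy (z k) *v v k = Hxy (z k) *v S (z k) (dy k) + Hxy (z k) *v S (z k) (e k)"
      by (simp add: S_add matrix_vector_right_distrib)
    then show ?thesis
      by (simp add: z_def d_def err_def field_def alg_x alg_y algebra_simps)
  qed
  have sum_err: "summable err"
  proof (rule summable_comparison_test'[of "\<lambda>k. Lg / \<mu> * (\<epsilon>2 k * \<eta> k)"])
    show "summable (\<lambda>k. Lg / \<mu> * (\<epsilon>2 k * \<eta> k))"
      by (intro summable_mult eps2_sum)
    fix k
    have "norm (Hxy (z k) *v S (z k) (e k)) \<le> Lg * (\<epsilon>2 k / \<mu>)"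
    proof -
      have "norm (e k) / \<mu> \<le> \<epsilon>2 k / \<mu>"
        using alg_v[of k] pos_consts by (intro divide_right_mono) (auto simp: e_def z_def)
      then show ?thesis
        using pos_consts by (intro order_trans[OF Hxy_bound] mult_left_mono order_trans[OF S_bound]) auto
    qed
    then have "\<eta> k * norm (Hxy (z k) *v S (z k) (e k)) \<le> \<eta> k * (Lg * (\<epsilon>2 k / \<mu>))"
      by (intro mult_left_mono eta_nonneg)
    then show "norm (err k) \<le> Lg / \<mu> * (\<epsilon>2 k * \<eta> k)"
      using eta_nonneg[of k] by (simp add: err_def norm_Pair mult_ac)
  qed
  \<comment> \<open>Adding the tails of the summable errors turns the iteration into an exact Euler scheme.\<close>
  define R where "R k = suminf err - (\<Sum>j<k. err j)" for k
  define Z where "Z k = z k + R k" for k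
  have R_lim: "R \<longlonglongrightarrow> 0"
    using tendsto_diff[OF tendsto_const summable_LIMSEQ[OF sum_err], of "suminf err"]
    by (simp add: R_def[abs_def])
  obtain B0 where B0: "\<And>k. norm (x k) + norm (y k) \<le> B0" using bdd by blast
  have z_bound: "norm (z k) \<le> B0" for k
    using order_trans[OF norm_Pair_le B0[of k]] by (simp add: z_def)
  obtain B1 where B1: "\<And>k. norm (R k) \<le> B1"
    using convergent_imp_Bseq[OF convergentI[OF R_lim]] by (auto simp: Bseq_def)
  define B where "B = B0 + B1"
  have B1_nonneg: "B1 \<ge> 0" using B1[of 0] norm_ge_zero order_trans by blast
  have z_bound': "norm (z k) \<le> B" for k
    using z_bound[of k] B1_nonneg by (simp add: B_def)
  have Z_bound: "norm (Z k) \<le> B" for k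
    unfolding Z_def B_def by (intro norm_triangle_le add_mono z_bound B1)
  have d_Df: "d k \<in> Df (fst (z k), snd (z k) - w k)" for k
    using alg_d[of k] by (simp add: d_def z_def)
  have norm_d: "norm (d k) \<le> Mf" for k
    using d_Df Df_vals by blast
  define C where "C = (Mf + Lg * (Mf / \<mu>)) + \<beta>h * (norm (Gy 0) + Lg * B0)"
  have field_bound: "norm (field (z k) (d k)) \<le> C" for k
  proof -
    have fs: "norm (fst (d k)) \<le> Mf" "norm (snd (d k)) \<le> Mf"
      using norm_d[of k] norm_fst_le[of "fst (d k)" "snd (d k)"] norm_snd_le[of "snd (d k)" "fst (d k)"] by auto
    have "norm (S (z k) (snd (d k))) \<le> Mf / \<mu>"
      using pos_consts fs by (intro order_trans[OF S_bound] divide_right_mono) auto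
    then have 1: "norm (fst (d k) - Hxy (z k) *v S (z k) (snd (d k))) \<le> Mf + Lg * (Mf / \<mu>)"
      using pos_consts fs by (intro norm_triangle_le_diff add_mono order_trans[OF Hxy_bound] mult_left_mono) auto
    have "norm (Gy (z k)) \<le> norm (Gy 0) + norm (Gy (z k) - Gy 0)"
      by (metis add.commute diff_add_cancel norm_triangle_ineq)
    also have "\<dots> \<le> norm (Gy 0) + Lg * B0"
      using Gy_lip[of "z k" 0] mult_left_mono[OF z_bound[of k] less_imp_le[OF pos_consts(3)]] by simp
    finally have "\<beta>h * norm (Gy (z k)) \<le> \<beta>h * (norm (Gy 0) + Lg * B0)"
      using betah_pos by (intro mult_left_mono) auto
    then show ?thesis
      unfolding field_def C_def using 1 betah_pos by (intro order_trans[OF norm_Pair_le] add_mono) auto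
  qed
  have w_lim: "(\<lambda>k. w k - newton (z k)) \<longlonglongrightarrow> 0"
  proof (rule Lim_null_comparison[of _ "\<lambda>k. \<epsilon>1 k / \<mu>"])
    show "\<forall>\<^sub>F k in sequentially. norm (w k - newton (z k)) \<le> \<epsilon>1 k / \<mu>"
    proof (intro always_eventually allI)
      fix k
      have "w k - newton (z k) = S (z k) (Hyy (z k) *v w k - Gy (z k))"
        by (simp add: newton_def S_diff)
      also have "norm \<dots> \<le> norm (Hyy (z k) *v w k - Gy (z k)) / \<mu>" by (rule S_bound)
      also have "\<dots> \<le> \<epsilon>1 k / \<mu>"
        using alg_w[of k] pos_consts by (intro divide_right_mono) (auto simp: z_def)
      finally show "norm (w k - newton (z k)) \<le> \<epsilon>1 k / \<mu>" .
    qed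
    show "(\<lambda>k. \<epsilon>1 k / \<mu>) \<longlonglongrightarrow> 0"
      using tendsto_divide[OF eps1_lim tendsto_const, of \<mu>] pos_consts by simp
  qed
  \<comment> \<open>The directions are evaluated at \<open>z k\<close> while the scheme moves
    \<open>Z k\<close>; since \<open>R\<close> tends to 0, both sequences have the same
    subsequential limits.\<close>
  interpret scheme: euler_scheme Z "\<lambda>k. field (z k) (d k)" \<eta> G B C
  proof
    show "Z (Suc k) = Z k - \<eta> k *\<^sub>R field (z k) (d k)" for k
      by (simp add: Z_def R_def step)
    show "\<eta> \<longlonglongrightarrow> 0"
      using summable_LIMSEQ_zero[OF eta_sq] by (simp add: power_eq_0_iff tendsto_null_power)
    show "l \<in> G u" if r: "strict_mono r" and Zr: "(\<lambda>j. Z (r j)) \<longlonglongrightarrow> u"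
      and l: "(\<lambda>j. field (z (r j)) (d (r j))) \<longlonglongrightarrow> l" for r u l
    proof (rule G_graph_limit)
      have "(\<lambda>j. Z (r j) - R (r j)) \<longlonglongrightarrow> u - 0"
        using LIMSEQ_subseq_LIMSEQ[OF R_lim r] by (intro tendsto_diff Zr) (simp add: o_def)
      then show zr: "(\<lambda>j. z (r j)) \<longlonglongrightarrow> u" by (simp add: Z_def)
      have "(\<lambda>j. (w (r j) - newton (z (r j))) + newton (z (r j))) \<longlonglongrightarrow> 0 + newton u"
        using LIMSEQ_subseq_LIMSEQ[OF w_lim r] by (intro tendsto_add newton_tendsto zr) (simp add: o_def)
      then show "(\<lambda>j. w (r j)) \<longlonglongrightarrow> newton u" by simp
    qed (use d_Df l in auto)
  qed (use eta_nonneg eta_sum Z_bound field_bound G_convex G_closed in auto)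
  have crit: "interior (h_fun f Gy Hyy \<beta> ` {z. 0 \<in> G z}) = {}"
  proof -
    have "h_fun f Gy Hyy \<beta> ` {z. 0 \<in> G z} \<subseteq> {f z | z. stationary_BLO Df Gy Hxy Hyy z}"
      using zero_in_G_imp_stationary by auto
    then show ?thesis using interior_mono crit_vals by blast
  qed
  have conv: "convergent (\<lambda>k. h_fun f Gy Hyy \<beta> (Z k))"
    by (rule scheme.lyapunov_convergence(1)[OF h_continuous _ crit]) (rule descent_along_curve)
  have zero_in_G: "0 \<in> G u" if "strict_mono r" "(\<lambda>j. Z (r j)) \<longlonglongrightarrow> u" for r u
    by (rule scheme.lyapunov_convergence(2)[OF h_continuous _ crit that]) (rule descent_along_curve)
  have "stationary_BLO Df Gy Hxy Hyy u"
    if r: "strict_mono r" and lim: "(\<lambda>k. (x (r k), y (r k))) \<longlonglongrightarrow> u" for u r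
  proof -
    have "(\<lambda>j. z (r j) + R (r j)) \<longlonglongrightarrow> u + 0"
      using LIMSEQ_subseq_LIMSEQ[OF R_lim r] lim by (intro tendsto_add) (simp_all add: o_def z_def)
    then have "(\<lambda>j. Z (r j)) \<longlonglongrightarrow> u" by (simp add: Z_def)
    with r have "0 \<in> G u" by (rule zero_in_G)
    then show ?thesis by (rule zero_in_G_imp_stationary)
  qed
  moreover have "convergent (\<lambda>k. h_fun f Gy Hyy \<beta> (z k))"
  proof (rule convergent_if_asymptotic[OF h_continuous conv])
    show "(\<lambda>k. Z k - z k) \<longlonglongrightarrow> 0" using R_lim by (simp add: Z_def)
  qed (rule Z_bound z_bound')+
  ultimately show ?thesis by (auto simp: z_def)
qed

end
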